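(* Consider the probit two-tier model and let $(A,\mathbf d,\Sigma_L)\in\mathfrak P$. Suppose that (C1) there exists a partition of the items $\{1,\dots,J\}=\mathcal B_1^*\cup\mathcal B_2^*$ into disjoint sets such that (1) $A[\mathcal B_1^*,:]$ has full column rank, and (2) there exists a subset $\mathcal B_{2a}^*\subseteq\mathcal B_2^*$ such that $A[\mathcal B_{2a}^*,:]$ has full column rank and $A[\mathcal B_2^*\setminus\{j\},:]$ has full column rank for every $j\in\mathcal B_{2a}^*$; and that at least one of the following holds: (T1S) $|\mathcal H_4|\ge 3$ and $A[\mathcal B_{\mathcal H_4},1{:}L]$ contains an identity; (T2S) $|\mathcal H_4|\ge 2$, $|\mathcal H_5|\ge 1$, and $A[\mathcal B_{\mathcal H_4},1{:}L]$ contains an identity; (T3S) $A[:,1{:}L]$ contains an identity, and there is a partition of the testlets $\{1,\dots,G\}=\mathcal G_1\cup\mathcal G_2$ into disjoint sets such that (a) $\bar A_{\mathcal G_1}$ has full column rank, and (b) $A[\mathcal B_{\mathcal G_2},1{:}L]$ has full column rank. Then the model is identifiable at $(A,\mathbf d,\Sigma_L)$.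
   Context: Probit two-tier model. Fix $L\ge1$ main factors, $G\ge 1$ testlets, and items $\{1,\dots,J\}$ with a fixed known partition into nonempty testlets $\mathcal B_1,\dots,\mathcal B_G$; $g_j\in\{1,\dots,G\}$ is the testlet containing item $j$. Parameters: a real $J\times(L+G)$ loading matrix $A=(a_{jk})$ whose columns $1,\dots,L$ are main-factor loadings and whose column $L+g$ contains the loadings on the factor of testlet $g$, with $a_{j,L+g}=0$ whenever $g\ne g_j$; intercepts $\mathbf d\in\mathbb R^J$; an $L\times L$ symmetric positive definite matrix $\Sigma_L$ with unit diagonal. The responses $Y_1,\dots,Y_J\in\{0,1\}$ are conditionally independent given $\boldsymbol\eta=(\eta_1,\dots,\eta_{L+G})^T\sim N\left(\mathbf 0,\begin{pmatrix}\Sigma_L&\mathbf 0\\ \mathbf 0&I_{G\times G}\end{pmatrix}\right)$, with $$P(Y_j=1\mid\boldsymbol\eta)=\Phi\Big(d_j+\sum_{l=1}^L a_{jl}\eta_l+a_{j,L+g_j}\eta_{L+g_j}\Big),$$ where $\Phi$ is the standard normal distribution function. The parameter space $\mathfrak P$ is the set of all such $(A,\mathbf d,\Sigma_L)$ for which the first nonzero entry of every column of $A$ is positive (no requirement on a zero column). For a matrix $X$ let $\mathbf I(X)$ be the 0/1 matrix with entries $\mathbf 1\{X_{ij}\ne0\}$. The model is identifiable at $(A,\mathbf d,\Sigma_L)\in\mathfrak P$ if every $(A',\mathbf d',\Sigma_L')\in\mathfrak P$ that defines the same (marginal) distribution of $(Y_1,\dots,Y_J)$ and satisfies $\mathbf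 I(A')=\mathbf I(A)$ equals $(A,\mathbf d,\Sigma_L)$. Notation: $A[\mathcal B,\mathcal C]$ is the submatrix with rows in $\mathcal B$ and columns in $\mathcal C$. For $\mathcal G\subseteq\{1,\dots,G\}$: $\mathcal B_{\mathcal G}=\bigcup_{g\in\mathcal G}\mathcal B_g$, $L+\mathcal G=\{L+g: g\in\mathcal G\}$, $\bar A_{\mathcal G}=(A[\mathcal B_{\mathcal G},1{:}L],A[\mathcal B_{\mathcal G},L+\mathcal G])$, and $\bar A_g=\bar A_{\{g\}}$. - $\mathcal H_4=\{g: A[\mathcal B_g,1{:}L]\text{ is of full column rank}\}$. - $\mathcal H_5=\{g:\bar A_g\text{ is of full column rank}\}$. - For a set $\mathcal B$ of items, "$A[\mathcal B,1{:}L]$ contains an identity" means: for each $l\in\{1,\dots,L\}$ there is an item in $\mathcal B$ whose loading on main factor $l$ is nonzero and whose loadings on all other main factors are zero (it may load on its testlet factor). *)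

theory Defs
  imports "HOL-Probability.Probability"
begin

text \<open>
  Items, main factors and testlets are indexed by finite types \<open>'j\<close>, \<open>'l\<close>, \<open>'g\<close>, so that
  \<open>J = CARD('j)\<close>, \<open>L = CARD('l)\<close> and \<open>G = CARD('g)\<close> are arbitrary positive integers.
  The columns of a loading matrix are indexed by \<open>'l + 'g\<close>: column \<open>Inl l\<close> is main factor \<open>l\<close>,
  column \<open>Inr g\<close> is the factor of testlet \<open>g\<close>.  The linear order on \<open>'j\<close> is only used
  to speak about the first nonzero entry of a column.
  The assignment of items to testlets is a map \<open>t :: 'j \<Rightarrow> 'g\<close> (\<open>g\<^sub>j\<close> is \<open>t j\<close>); the testlet
  \<open>g\<close> is \<open>t -` {g}\<close>, and all testlets are nonempty iff \<open>t\<close> is surjective.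
\<close>

type_synonym ('j, 'l, 'g) two_tier_params =
  "(real ^ ('l + 'g) ^ 'j) \<times> (real ^ 'j) \<times> (real ^ 'l ^ 'l)"


subsection \<open>The model\<close>

definition sym_pos_def :: "real ^ 'n ^ 'n \<Rightarrow> bool" where
  "sym_pos_def S \<longleftrightarrow> transpose S = S \<and> (\<forall>x. x \<noteq> 0 \<longrightarrow> 0 < x \<bullet> (S *v x))"

text \<open>The law \<open>N(0, S)\<close>, given by its density; meant for \<open>sym_pos_def S\<close>.\<close>

definition centred_normal :: "real ^ 'n ^ 'n \<Rightarrow> (real ^ 'n) measure" where
  "centred_normal S = density lborel (\<lambda>x. ennreal
     (exp (- (x \<bullet> (matrix_inv S *v x)) / 2) / sqrt ((2 * pi) ^ CARD('n) * det S)))"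

definition factor_cov :: "real ^ 'l::finite ^ 'l \<Rightarrow> real ^ ('l + 'g::finite) ^ ('l + 'g)" where
  "factor_cov S = (\<chi> a b. case (a, b) of
       (Inl l, Inl l') \<Rightarrow> S $ l $ l'
     | (Inr g, Inr g') \<Rightarrow> (if g = g' then 1 else 0)
     | _ \<Rightarrow> 0)"

definition std_normal_cdf :: "real \<Rightarrow> real" where
  "std_normal_cdf = cdf std_normal_distribution"

definition correct_prob ::
  "('j \<Rightarrow> 'g::finite) \<Rightarrow> real ^ ('l::finite + 'g) ^ 'j \<Rightarrow> real ^ 'j \<Rightarrow> real ^ ('l + 'g) \<Rightarrow> 'j \<Rightarrow> real" where
  "correct_prob t A d \<eta> j = std_normal_cdf
     (d $ j + (\<Sum>l\<in>UNIV. A $ j $ Inl l * \<eta> $ Inl l) + A $ j $ Inr (t j) * \<eta> $ Inr (t j))"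

text \<open>Given \<open>\<eta>\<close>, the responses are independent Bernoulli variables (\<open>True\<close> is response 1).\<close>

definition cond_response_pmf ::
  "('j::finite \<Rightarrow> 'g::finite) \<Rightarrow> real ^ ('l::finite + 'g) ^ 'j \<Rightarrow> real ^ 'j \<Rightarrow> real ^ ('l + 'g) \<Rightarrow> ('j \<Rightarrow> bool) pmf"
  where
  "cond_response_pmf t A d \<eta> = Pi_pmf UNIV False (\<lambda>j. bernoulli_pmf (correct_prob t A d \<eta> j))"

definition response_distribution ::
  "('j::finite \<Rightarrow> 'g::finite) \<Rightarrow> ('j, 'l::finite, 'g) two_tier_params \<Rightarrow> ('j \<Rightarrow> bool) measure" where
  "response_distribution t = (\<lambda>(A, d, S).
     centred_normal (factor_cov S) \<bind> (\<lambda>\<eta>. measure_pmf (cond_response_pmf t A d \<eta>)))"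


text \<open>Hence the point masses are the usual marginal likelihoods.\<close>

lemma emeasure_response_distribution:
  fixes A :: "real ^ ('l::finite + 'g::finite) ^ 'j"
  shows "emeasure (response_distribution t (A, d, S)) {y} =
    (\<integral>\<^sup>+\<eta>. ennreal (\<Prod>j\<in>UNIV. if y j then correct_prob t A d \<eta> j else 1 - correct_prob t A d \<eta> j)
       \<partial>centred_normal (factor_cov S))"
proof -
  interpret R: real_distribution std_normal_distribution
    by (simp add: real_distribution_def real_distribution_axioms_def prob_space_normal_density)
  let ?M = "centred_normal (factor_cov S) :: (real ^ ('l + 'g)) measure"
  let ?K = "\<lambda>\<eta>. measure_pmf (cond_response_pmf t A d \<eta>)"
  have Phi01: "0 \<le> std_normal_cdf x" "std_normal_cdf x \<le> 1" for x
    by (auto simp: std_normal_cdf_def cdf_def)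
  then have p01: "0 \<le> correct_prob t A d \<eta> j" "correct_prob t A d \<eta> j \<le> 1" for \<eta> j
    by (auto simp: correct_prob_def)
  have Phi_meas: "std_normal_cdf \<in> borel_measurable borel"
    unfolding std_normal_cdf_def
    by (rule borel_measurable_mono) (auto simp: mono_def intro: R.cdf_nondecreasing)
  have p_meas: "(\<lambda>\<eta>. correct_prob t A d \<eta> j) \<in> borel_measurable borel" for j
    unfolding correct_prob_def
    by (rule measurable_compose[OF _ Phi_meas]) simp
  have pmf: "pmf (cond_response_pmf t A d \<eta>) z =
      (\<Prod>j\<in>UNIV. if z j then correct_prob t A d \<eta> j else 1 - correct_prob t A d \<eta> j)" for \<eta> z
    unfolding cond_response_pmf_def
    by (subst pmf_Pi') (auto simp: p01 intro!: prod.cong)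
  have pmf_meas: "(\<lambda>\<eta>. pmf (cond_response_pmf t A d \<eta>) z) \<in> borel_measurable borel" for z
    unfolding pmf using p_meas by (intro borel_measurable_prod) auto
  have spaceM: "space ?M = UNIV" and setsM: "sets ?M = sets borel"
    by (simp_all add: centred_normal_def)
  have K: "?K \<in> measurable ?M (subprob_algebra (count_space UNIV))"
  proof (rule measurable_subprob_algebra)
    fix X :: "('j \<Rightarrow> bool) set"
    have "(\<lambda>\<eta>. emeasure (?K \<eta>) X) = (\<lambda>\<eta>. \<Sum>z\<in>X. ennreal (pmf (cond_response_pmf t A d \<eta>) z))"
      by (simp add: emeasure_measure_pmf_finite)
    also have "\<dots> \<in> borel_measurable borel"
      using pmf_meas by (intro borel_measurable_sum) auto
    finally show "(\<lambda>\<eta>. emeasure (?K \<eta>) X) \<in> borel_measurable ?M"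
      by (simp add: measurable_cong_sets[OF setsM refl])
  qed (auto intro: prob_space_imp_subprob_space prob_space_measure_pmf)
  show ?thesis
    unfolding response_distribution_def prod.case
    by (subst emeasure_bind[OF _ K]) (auto simp: spaceM emeasure_pmf_single pmf)
qed


subsection \<open>Parameter space and identifiability\<close>

definition param_space ::
  "('j::{finite,linorder} \<Rightarrow> 'g::finite) \<Rightarrow> ('j, 'l::finite, 'g) two_tier_params set" where
  "param_space t = {(A, d, S).
      (\<forall>j g. g \<noteq> t j \<longrightarrow> A $ j $ Inr g = 0) \<and>
      sym_pos_def S \<and> (\<forall>l. S $ l $ l = 1) \<and>
      (\<forall>k j. A $ j $ k \<noteq> 0 \<and> (\<forall>i<j. A $ i $ k = 0) \<longrightarrow> 0 < A $ j $ k)}"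

definition nonzero_pattern :: "real ^ 'n ^ 'm \<Rightarrow> real ^ 'n ^ 'm" where
  "nonzero_pattern X = (\<chi> i j. if X $ i $ j \<noteq> 0 then 1 else 0)"

definition identifiable_at ::
  "('j::{finite,linorder} \<Rightarrow> 'g::finite) \<Rightarrow> ('j, 'l::finite, 'g) two_tier_params \<Rightarrow> bool" where
  "identifiable_at t p \<longleftrightarrow> (\<forall>p' \<in> param_space t.
      response_distribution t p' = response_distribution t p \<and>
      nonzero_pattern (fst p') = nonzero_pattern (fst p) \<longrightarrow> p' = p)"


subsection \<open>Rank conditions on submatrices\<close>

text \<open>
  The submatrix with rows in \<open>B\<close> and columns in \<open>C\<close> is represented by padding it with zero rows
  and columns, which does not change its rank; it has \<open>card C\<close> columns.
\<close>

definition padded_submatrix :: "real ^ 'n ^ 'm \<Rightarrow> 'm set \<Rightarrow> 'n set \<Rightarrow> real ^ 'n ^ 'm" where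
  "padded_submatrix A B C = (\<chi> i k. if i \<in> B \<and> k \<in> C then A $ i $ k else 0)"

definition full_col_rank :: "real ^ 'n ^ 'm \<Rightarrow> 'm set \<Rightarrow> 'n set \<Rightarrow> bool" where
  "full_col_rank A B C \<longleftrightarrow> rank (padded_submatrix A B C) = card C"

abbreviation main_cols :: "('l + 'g) set" where
  "main_cols \<equiv> range Inl"

definition full_col_rank_bar ::
  "('j \<Rightarrow> 'g::finite) \<Rightarrow> real ^ ('l::finite + 'g) ^ 'j \<Rightarrow> 'g set \<Rightarrow> bool" where
  "full_col_rank_bar t A \<G> \<longleftrightarrow> full_col_rank A (t -` \<G>) (main_cols \<union> Inr ` \<G>)"

definition H4 :: "('j \<Rightarrow> 'g::finite) \<Rightarrow> real ^ ('l::finite + 'g) ^ 'j \<Rightarrow> 'g set" where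
  "H4 t A = {g. full_col_rank A (t -` {g}) main_cols}"

definition H5 :: "('j \<Rightarrow> 'g::finite) \<Rightarrow> real ^ ('l::finite + 'g) ^ 'j \<Rightarrow> 'g set" where
  "H5 t A = {g. full_col_rank_bar t A {g}}"

definition contains_identity :: "real ^ ('l::finite + 'g::finite) ^ 'j \<Rightarrow> 'j set \<Rightarrow> bool" where
  "contains_identity A B \<longleftrightarrow>
     (\<forall>l. \<exists>j\<in>B. A $ j $ Inl l \<noteq> 0 \<and> (\<forall>l'. l' \<noteq> l \<longrightarrow> A $ j $ Inl l' = 0))"

definition cond_C1 :: "real ^ ('l::finite + 'g::finite) ^ 'j \<Rightarrow> bool" where
  "cond_C1 A \<longleftrightarrow> (\<exists>B1 B2. B1 \<union> B2 = UNIV \<and> B1 \<inter> B2 = {} \<and>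
      full_col_rank A B1 UNIV \<and>
      (\<exists>B2a \<subseteq> B2. full_col_rank A B2a UNIV \<and>
         (\<forall>j\<in>B2a. full_col_rank A (B2 - {j}) UNIV)))"

definition cond_T1S :: "('j \<Rightarrow> 'g::finite) \<Rightarrow> real ^ ('l::finite + 'g) ^ 'j \<Rightarrow> bool" where
  "cond_T1S t A \<longleftrightarrow> card (H4 t A) \<ge> 3 \<and> contains_identity A (t -` H4 t A)"

definition cond_T2S :: "('j \<Rightarrow> 'g::finite) \<Rightarrow> real ^ ('l::finite + 'g) ^ 'j \<Rightarrow> bool" where
  "cond_T2S t A \<longleftrightarrow> card (H4 t A) \<ge> 2 \<and> card (H5 t A) \<ge> 1 \<and> contains_identity A (t -` H4 t A)"

definition cond_T3S :: "('j \<Rightarrow> 'g::finite) \<Rightarrow> real ^ ('l::finite + 'g) ^ 'j \<Rightarrow> bool" where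
  "cond_T3S t A \<longleftrightarrow> contains_identity A UNIV \<and>
     (\<exists>\<G>1 \<G>2. \<G>1 \<union> \<G>2 = UNIV \<and> \<G>1 \<inter> \<G>2 = {} \<and>
        full_col_rank_bar t A \<G>1 \<and> full_col_rank A (t -` \<G>2) main_cols)"

end

theory Submission
  imports Defs
begin

text \<open>
  Writing \<open>Y\<^sub>j = 1\<close> iff \<open>Z\<^sub>j \<le> d\<^sub>j + a\<^sub>j \<bullet> \<eta>\<close> with independent standard normal noise \<open>Z\<^sub>j\<close>, the
  responses are signs of jointly Gaussian variables with variances \<open>s\<^sub>j\<^sup>2 = 1 + a\<^sub>j \<bullet> \<Omega> a\<^sub>j\<close> and
  covariances \<open>a\<^sub>i \<bullet> \<Omega> a\<^sub>j\<close>, where \<open>\<Omega>\<close> is the factor covariance. The proof recovers the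
  parameters in three stages.

  The first stage uses single responses and pairs of responses. One response has success
  probability \<open>\<Phi>(d\<^sub>j / s\<^sub>j)\<close>. Two responses succeed together with a probability which, for given
  standardized intercepts, is an injective function of the correlation
  \<open>a\<^sub>i \<bullet> \<Omega> a\<^sub>j / (s\<^sub>i s\<^sub>j)\<close> (\<open>orthant_prob_neq\<close>). So these correlations, for \<open>i \<noteq> j\<close>, and the
  standardized intercepts are determined (\<open>standardized_intercept_determined\<close>,
  \<open>correlation_determined\<close>). The orthant probability is reduced to a one-dimensional integral by
  writing the two linear forms in an \<open>\<Omega>\<close>-orthonormal basis (\<open>centred_normal_two_forms\<close>).

  The second stage completes the diagonal. The vectors \<open>a\<^sub>j / s\<^sub>j\<close> live in dimension \<open>L + G\<close>, and
  two systems of vectors in a space of that dimension whose Gram matrices agree on \<open>U \<times> V\<close>, with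
  the vectors of \<open>U\<close> spanning, are related on \<open>V\<close> by a linear map (\<open>gram_agree_linear\<close>). Under
  condition (C1) this forces the Gram matrices to agree on the diagonal as well
  (\<open>gram_diagonal_determined\<close>). The diagonal entries \<open>1 - 1 / s\<^sub>j\<^sup>2\<close> give \<open>s\<^sub>j\<close>, hence the intercepts
  and the full matrix of covariances \<open>a\<^sub>i \<bullet> \<Omega> a\<^sub>j\<close> (\<open>two_tier_covariances_determined\<close>).

  The third stage separates main factors and testlets. Between different testlets the covariance is
  \<open>m\<^sub>i \<bullet> \<Sigma> m\<^sub>j\<close>, with \<open>m\<^sub>i\<close> the main loadings of item \<open>i\<close>; within a testlet the product of the
  testlet loadings is added. Both (T1S) (\<open>gram_agree_three_groups\<close>) and (T3S)
  (\<open>gram_agree_two_halves\<close>) imply that the matrix of all \<open>m\<^sub>i \<bullet> \<Sigma> m\<^sub>j\<close> is determined; (T2S) is a case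
  of (T3S), where a testlet of \<open>\<H>\<^sub>5\<close> is split off from the remaining ones. Then the main loadings are
  determined up to a linear map, which is diagonal with entries \<open>\<plusminus>1\<close> since the zero pattern is kept
  on the identity rows and \<open>\<Sigma>\<close> has unit diagonal; the sign convention makes it the identity
  (\<open>main_part_determined\<close>). The products of the testlet loadings are then known too, and with the
  sign convention so are the loadings.
\<close>

section \<open>Positive definite matrices\<close>

lemma matrix_vector_inner_transpose:
  fixes S :: "real^'n^'n"
  shows "x \<bullet> (S *v y) = (transpose S *v x) \<bullet> y"
  by (simp add: dot_lmul_matrix transpose_matrix_vector)

lemma sym_pos_def_inner_commute:
  assumes "sym_pos_def S"
  shows "x \<bullet> (S *v y) = y \<bullet> (S *v x)"
proof -
  have "x \<bullet> (S *v y) = (transpose S *v x) \<bullet> y" by (rule matrix_vector_inner_transpose)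
  also have "transpose S = S" using assms by (simp add: sym_pos_def_def)
  finally show ?thesis by (simp add: inner_commute)
qed

lemma sym_pos_def_inj:
  assumes "sym_pos_def S" "S *v y = S *v z"
  shows "y = z"
proof (rule ccontr)
  assume "y \<noteq> z"
  then have "0 < (y - z) \<bullet> (S *v (y - z))"
    using assms(1) unfolding sym_pos_def_def by simp
  also have "S *v (y - z) = 0"
    using assms(2) by (simp add: matrix_vector_mult_diff_distrib)
  finally show False by simp
qed

section \<open>Full column rank and spanning rows\<close>

lemma eq_if_inner_spanning:
  fixes x :: "'i \<Rightarrow> 'a::real_inner"
  assumes "span (x ` U) = UNIV" and "\<And>u. u \<in> U \<Longrightarrow> x u \<bullet> y = x u \<bullet> z"
  shows "y = z"
proof -
  have "w \<bullet> (y - z) = 0" for w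
  proof -
    have "w \<in> span (x ` U)" using assms(1) by simp
    moreover have "subspace {w. w \<bullet> (y - z) = 0}"
      by (auto simp: subspace_def inner_add_left)
    moreover have "x ` U \<subseteq> {w. w \<bullet> (y - z) = 0}"
      using assms(2) by (auto simp: inner_diff_right)
    ultimately show ?thesis using span_minimal by blast
  qed
  from this[of "y - z"] show ?thesis by simp
qed

text \<open>
  The usable form of full column rank: the row space of the submatrix lies in the
  coordinate space of \<open>C\<close> and has the same dimension, so some combination of the rows takes any
  prescribed values on the columns \<open>C\<close>.
\<close>

lemma full_col_rank_solvable:
  fixes A :: "real^'n^'m"
  assumes "full_col_rank A B C"
  shows "\<exists>x. \<forall>k\<in>C. (\<Sum>i\<in>B. x i * A $ i $ k) = z k"
proof -
  let ?T = "transpose (padded_submatrix A B C)"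
  let ?V = "{v :: real^'n. \<forall>k. k \<notin> C \<longrightarrow> v $ k = 0}"
  have T: "(?T *v w) $ k = (if k \<in> C then \<Sum>i\<in>B. w $ i * A $ i $ k else 0)" for w k
  proof -
    have "(?T *v w) $ k = (\<Sum>i\<in>UNIV. if i \<in> B then (if k \<in> C then w $ i * A $ i $ k else 0) else 0)"
      by (auto simp: matrix_vector_mult_def transpose_def padded_submatrix_def intro!: sum.cong)
    then show ?thesis by (simp add: sum.If_cases)
  qed
  have "range ((*v) ?T) = ?V"
  proof (rule subspace_dim_equal)
    show "subspace (range ((*v) ?T))"
      by (intro linear_subspace_image matrix_vector_mul_linear subspace_UNIV)
    show "subspace ?V" by (auto simp: subspace_def)
    show "range ((*v) ?T) \<subseteq> ?V" 
    proof
      fix v assume "v \<in> range ((*v) ?T)"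
      then obtain w where "v = ?T *v w" by blast
      then show "v \<in> ?V" by (simp only: T mem_Collect_eq) simp
    qed
    have "dim ?V = card C" 
      by (subst dim_vec_eq[symmetric]) (rule dim_substandard_cart)
    also have "\<dots> = dim (range ((*v) ?T))"
      using assms by (simp only: full_col_rank_def rank_dim_range[symmetric] rank_transpose)
    finally show "dim ?V \<le> dim (range ((*v) ?T))" by simp
  qed
  moreover have "(\<chi> k. if k \<in> C then z k else 0) \<in> ?V" by simp
  ultimately obtain w where "(\<chi> k. if k \<in> C then z k else 0) = ?T *v w" by blast
  from arg_cong[OF this, of "\<lambda>v. v $ k" for k]
  have eq: "(if k \<in> C then z k else 0) = (?T *v w) $ k" for k
    by (simp only: vec_lambda_beta)
  have "(\<Sum>i\<in>B. w $ i * A $ i $ k) = z k" if "k \<in> C" for k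
    using eq[of k] that unfolding T by simp
  then show ?thesis by blast
qed

lemma spanning_if_solvable:
  fixes v :: "'i \<Rightarrow> 'a::real_vector"
  assumes "\<And>z. \<exists>x. (\<Sum>i\<in>B. x i *\<^sub>R v i) = z"
  shows "span (v ` B) = UNIV"
proof -
  have "z \<in> span (v ` B)" for z
  proof -
    obtain x where "z = (\<Sum>i\<in>B. x i *\<^sub>R v i)" using assms by metis
    then show ?thesis by (auto intro: span_sum span_scale span_base)
  qed
  then show ?thesis by blast
qed

lemma spanning_rows:
  fixes A :: "real^'n^'m"
  assumes "full_col_rank A B UNIV"
  shows "span (($) A ` B) = UNIV"
proof (rule spanning_if_solvable)
  fix z :: "real^'n"
  obtain x where "\<forall>k\<in>UNIV. (\<Sum>i\<in>B. x i * A $ i $ k) = z $ k"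
    using full_col_rank_solvable[OF assms] by blast
  then show "\<exists>x. (\<Sum>i\<in>B. x i *\<^sub>R A $ i) = z" by (intro exI[of _ x]) (simp add: vec_eq_iff)
qed

lemma spanning_scaled:
  fixes v :: "'i \<Rightarrow> 'a::real_vector"
  assumes "span (v ` B) = UNIV" and "\<And>i. i \<in> B \<Longrightarrow> c i \<noteq> 0"
  shows "span ((\<lambda>i. c i *\<^sub>R v i) ` B) = UNIV"
proof -
  have "v i \<in> span ((\<lambda>i. c i *\<^sub>R v i) ` B)" if "i \<in> B" for i
    using span_scale[OF span_base, of "c i *\<^sub>R v i" "(\<lambda>i. c i *\<^sub>R v i) ` B" "1 / c i"] that assms(2)[OF that]
    by simp
  then have "span (v ` B) \<subseteq> span ((\<lambda>i. c i *\<^sub>R v i) ` B)"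
    by (intro span_minimal) auto
  then show ?thesis using assms(1) by auto
qed

section \<open>Gaussian integrals of the probit function\<close>

abbreviation "N01 \<equiv> std_normal_distribution"

lemma prob_space_std_normal: "prob_space N01"
  by (simp add: prob_space_normal_density)

lemma real_distribution_std_normal: "real_distribution N01"
  by (simp add: real_distribution_def real_distribution_axioms_def prob_space_std_normal)

lemma nn_integral_std_normal:
  "f \<in> borel_measurable borel \<Longrightarrow>
    (\<integral>\<^sup>+x. f x \<partial>N01) = (\<integral>\<^sup>+x. ennreal (std_normal_density x) * f x \<partial>lborel)"
  by (subst nn_integral_density) auto

lemma std_normal_cdf_range: "0 \<le> std_normal_cdf x" "std_normal_cdf x \<le> 1"
proof -
  interpret real_distribution N01 by (rule real_distribution_std_normal)
  show "0 \<le> std_normal_cdf x" "std_normal_cdf x \<le> 1"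
    by (auto simp: std_normal_cdf_def cdf_def)
qed

lemma ennreal_std_normal_cdf: "ennreal (std_normal_cdf x) = emeasure N01 {..x}"
proof -
  interpret real_distribution N01 by (rule real_distribution_std_normal)
  show ?thesis by (simp add: std_normal_cdf_def cdf_def emeasure_eq_measure)
qed

lemma std_normal_cdf_measurable [measurable]: "std_normal_cdf \<in> borel_measurable borel"
proof -
  interpret real_distribution N01 by (rule real_distribution_std_normal)
  show ?thesis
    unfolding std_normal_cdf_def
    by (rule borel_measurable_mono) (auto simp: mono_def intro: cdf_nondecreasing)
qed

text \<open>
  The normal density is positive everywhere, so normal null sets are Lebesgue null sets. This turns
  non-strict inequalities between normal integrals into strict ones.
\<close>

lemma AE_notin_if_std_normal_null:
  assumes [measurable]: "X \<in> sets borel" and "emeasure N01 X = 0"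
  shows "AE x in lborel. x \<notin> X"
proof -
  have "X \<in> null_sets N01" using assms by (auto simp: null_sets_def)
  then have "AE x in N01. x \<notin> X" by (rule AE_not_in)
  then show ?thesis by (subst (asm) AE_density) (auto simp: normal_density_pos)
qed

lemma std_normal_cdf_strict_mono: "strict_mono std_normal_cdf"
proof (rule strict_monoI)
  fix x y :: real assume "x < y"
  interpret real_distribution N01 by (rule real_distribution_std_normal)
  have diff: "std_normal_cdf y - std_normal_cdf x = measure N01 {x<..y}"
    using cdf_diff_eq[OF \<open>x < y\<close>] by (simp add: std_normal_cdf_def)
  have "measure N01 {x<..y} \<noteq> 0"
  proof
    assume "measure N01 {x<..y} = 0"
    then have "AE z in lborel. z \<notin> {x<..y}"
      by (intro AE_notin_if_std_normal_null) (auto simp: emeasure_eq_measure)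
    then have "emeasure lborel {x<..y} = 0"
      by (subst (asm) AE_iff_measurable[where N = "{x<..y}"]) auto
    then show False using \<open>x < y\<close> by simp
  qed
  then show "std_normal_cdf x < std_normal_cdf y"
    using diff measure_nonneg[of N01 "{x<..y}"] by linarith
qed

text \<open>
  With \<open>y = a z + s x\<close> and \<open>w = s z + a x\<close>, the pair \<open>(x, w)\<close> arises from \<open>(y, z)\<close> by the rotation
  with cosine \<open>1 / s\<close> and sine \<open>a / s\<close>, which preserves the planar Gaussian density.
\<close>

lemma std_normal_density_rotate:
  assumes "s\<^sup>2 = 1 + a\<^sup>2"
  shows "std_normal_density (a * z + s * x) * std_normal_density z
       = std_normal_density x * std_normal_density (s * z + a * x)"
proof -
  have "(a * z + s * x)\<^sup>2 + z\<^sup>2 = x\<^sup>2 + (s * z + a * x)\<^sup>2"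
    using assms by (simp add: power2_sum power_mult_distrib algebra_simps)
  then have "exp (- (a * z + s * x)\<^sup>2 / 2) * exp (- z\<^sup>2 / 2)
      = exp (- x\<^sup>2 / 2) * exp (- (s * z + a * x)\<^sup>2 / 2)"
    unfolding exp_add [symmetric] by (simp add: field_simps)
  then show ?thesis
    by (simp add: std_normal_density_def mult.assoc mult.left_commute)
qed

text \<open>
  For independent standard normal \<open>z\<close> and \<open>y\<close>, the event \<open>y \<le> d + a z\<close> says that the standard normal
  variable \<open>x = (y - a z) / s\<close> is at most \<open>d / s\<close>. Given \<open>x\<close>, the law of \<open>z\<close> is that of
  \<open>(w - a x) / s\<close> with \<open>w\<close> standard normal. This Gaussian conditioning is the only computation behind
  all probit integrals below.
\<close>

lemma nn_integral_std_normal_cdf_affine: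
  fixes f :: "real \<Rightarrow> ennreal" and a d :: real
  assumes f[measurable]: "f \<in> borel_measurable borel"
  defines "s \<equiv> sqrt (1 + a\<^sup>2)"
  shows "(\<integral>\<^sup>+z. ennreal (std_normal_cdf (d + a * z)) * f z \<partial>N01)
       = (\<integral>\<^sup>+x. indicator {..d / s} x * (\<integral>\<^sup>+w. f ((w - a * x) / s) \<partial>N01) \<partial>N01)"
proof -
  let ?p = "\<lambda>x. ennreal (std_normal_density x)"
  have s: "s > 0" "s\<^sup>2 = 1 + a\<^sup>2" by (auto simp: s_def add_pos_nonneg)
  have Phi: "ennreal (std_normal_cdf (d + a * z)) =
      (\<integral>\<^sup>+x. ennreal s * (?p (a * z + s * x) * indicator {..d / s} x) \<partial>lborel)" for z
  proof -
    have "ennreal (std_normal_cdf (d + a * z)) = (\<integral>\<^sup>+y. ?p y * indicator {..d + a * z} y \<partial>lborel)"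
      unfolding ennreal_std_normal_cdf by (subst emeasure_density) auto
    also have "\<dots> = ennreal s * (\<integral>\<^sup>+x. ?p (a * z + s * x) * indicator {..d + a * z} (a * z + s * x) \<partial>lborel)"
      using s by (subst nn_integral_real_affine[where c = s and t = "a * z"]) auto
    also have "(\<lambda>x. indicator {..d + a * z} (a * z + s * x) :: ennreal) = indicator {..d / s}"
      using s by (auto simp: indicator_def fun_eq_iff field_simps)
    finally show ?thesis by (simp add: nn_integral_cmult)
  qed
  have inner: "(\<integral>\<^sup>+z. ennreal s * (?p (a * z + s * x) * ?p z * f z) \<partial>lborel)
      = ?p x * (\<integral>\<^sup>+w. f ((w - a * x) / s) \<partial>N01)" for x
  proof -
    have "(\<integral>\<^sup>+w. f ((w - a * x) / s) \<partial>N01) = (\<integral>\<^sup>+w. ?p w * f ((w - a * x) / s) \<partial>lborel)"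
      by (rule nn_integral_std_normal) measurable
    also have "\<dots> = ennreal s * (\<integral>\<^sup>+z. ?p (a * x + s * z) * f ((a * x + s * z - a * x) / s) \<partial>lborel)"
      using s by (subst nn_integral_real_affine[where c = s and t = "a * x"]) auto
    also have "\<dots> = ennreal s * (\<integral>\<^sup>+z. ?p (s * z + a * x) * f z \<partial>lborel)"
      using s by (simp add: add.commute)
    finally have "?p x * (\<integral>\<^sup>+w. f ((w - a * x) / s) \<partial>N01)
        = ennreal s * (\<integral>\<^sup>+z. ?p x * ?p (s * z + a * x) * f z \<partial>lborel)"
      by (simp add: nn_integral_cmult[symmetric] mult_ac)
    also have "(\<lambda>z. ?p x * ?p (s * z + a * x) * f z) = (\<lambda>z. ?p (a * z + s * x) * ?p z * f z)"
      using std_normal_density_rotate[OF s(2)]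
      by (simp add: ennreal_mult'[symmetric] fun_eq_iff)
    finally show ?thesis by (simp add: nn_integral_cmult)
  qed
  have "(\<integral>\<^sup>+z. ennreal (std_normal_cdf (d + a * z)) * f z \<partial>N01)
      = (\<integral>\<^sup>+z. ?p z * (ennreal (std_normal_cdf (d + a * z)) * f z) \<partial>lborel)"
    by (rule nn_integral_std_normal) measurable
  also have "\<dots> = (\<integral>\<^sup>+z. (\<integral>\<^sup>+x. indicator {..d / s} x * (ennreal s * (?p (a * z + s * x) * ?p z * f z)) \<partial>lborel) \<partial>lborel)"
    unfolding Phi
    by (intro nn_integral_cong)
       (simp add: nn_integral_cmult[symmetric] nn_integral_multc[symmetric] mult_ac)
  also have "\<dots> = (\<integral>\<^sup>+x. (\<integral>\<^sup>+z. indicator {..d / s} x * (ennreal s * (?p (a * z + s * x) * ?p z * f z)) \<partial>lborel) \<partial>lborel)"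
    by (rule lborel_pair.Fubini'[symmetric]) measurable
  also have "\<dots> = (\<integral>\<^sup>+x. ?p x * (indicator {..d / s} x * (\<integral>\<^sup>+w. f ((w - a * x) / s) \<partial>N01)) \<partial>lborel)"
  proof (rule nn_integral_cong)
    fix x :: real
    show "(\<integral>\<^sup>+z. indicator {..d / s} x * (ennreal s * (?p (a * z + s * x) * ?p z * f z)) \<partial>lborel)
        = ?p x * (indicator {..d / s} x * (\<integral>\<^sup>+w. f ((w - a * x) / s) \<partial>N01))"
      by (subst nn_integral_cmult, measurable) (simp only: inner mult.left_commute)
  qed
  also have "\<dots> = (\<integral>\<^sup>+x. indicator {..d / s} x * (\<integral>\<^sup>+w. f ((w - a * x) / s) \<partial>N01) \<partial>N01)"
  proof (rule nn_integral_std_normal[symmetric])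
    interpret prob_space N01 by (rule prob_space_std_normal)
    show "(\<lambda>x. indicator {..d / s} x * (\<integral>\<^sup>+w. f ((w - a * x) / s) \<partial>N01)) \<in> borel_measurable borel"
      by measurable
  qed
  finally show ?thesis .
qed

text \<open>
  A normal variable plus independent normal noise is normal with the sum of the variances.
\<close>

lemma std_normal_cdf_mixture:
  assumes s: "s > 0"
  shows "(\<integral>\<^sup>+z. ennreal (std_normal_cdf ((x + c * z) / s)) \<partial>N01)
       = ennreal (std_normal_cdf (x / sqrt (s\<^sup>2 + c\<^sup>2)))"
proof -
  interpret prob_space N01 by (rule prob_space_std_normal)
  have eq: "x / s / sqrt (1 + (c / s)\<^sup>2) = x / sqrt (s\<^sup>2 + c\<^sup>2)"
  proof -
    have "s\<^sup>2 + c\<^sup>2 = s\<^sup>2 * (1 + (c / s)\<^sup>2)" using s by (simp add: field_simps)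
    then have "sqrt (s\<^sup>2 + c\<^sup>2) = s * sqrt (1 + (c / s)\<^sup>2)"
      using s by (simp add: real_sqrt_mult)
    then show ?thesis by simp
  qed
  have "(\<integral>\<^sup>+z. ennreal (std_normal_cdf ((x + c * z) / s)) \<partial>N01)
      = (\<integral>\<^sup>+z. ennreal (std_normal_cdf (x / s + (c / s) * z)) * 1 \<partial>N01)"
    by (simp add: add_divide_distrib)
  also have "\<dots> = (\<integral>\<^sup>+z. indicator {..x / s / sqrt (1 + (c / s)\<^sup>2)} z * (\<integral>\<^sup>+w. 1 \<partial>N01) \<partial>N01)"
    by (rule nn_integral_std_normal_cdf_affine) simp
  also have "\<dots> = emeasure N01 {..x / sqrt (s\<^sup>2 + c\<^sup>2)}"
    using emeasure_space_1 by (simp add: eq del: divide_divide_eq_left)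
  finally show ?thesis by (simp add: ennreal_std_normal_cdf)
qed

text \<open>
  The bivariate normal distribution function: the probability that two standard normal variables with
  correlation \<open>r\<close> are at most \<open>u\<close> and \<open>v\<close>, by conditioning on the first one.
\<close>

definition orthant_prob :: "real \<Rightarrow> real \<Rightarrow> real \<Rightarrow> ennreal" where
  "orthant_prob u v r = (\<integral>\<^sup>+x. indicator {..u} x * ennreal (std_normal_cdf ((v - r * x) / sqrt (1 - r\<^sup>2))) \<partial>N01)"

text \<open>
  Integrating out \<open>y\<close> leaves a product of two probit functions of one normal variable; the
  conditioning lemma turns the first of them into the range of integration.
\<close>

lemma orthant_prob_standardize:
  fixes a b c d e :: real
  defines "s \<equiv> sqrt (1 + a\<^sup>2)" and "t \<equiv> sqrt (1 + b\<^sup>2 + c\<^sup>2)"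
  shows "(\<integral>\<^sup>+z. \<integral>\<^sup>+y. ennreal (std_normal_cdf (d + a * z)) * ennreal (std_normal_cdf (e + b * z + c * y)) \<partial>N01 \<partial>N01)
       = orthant_prob (d / s) (e / t) (a * b / (s * t))"
proof -
  let ?c = "sqrt (1 + c\<^sup>2)" and ?r = "a * b / (s * t)"
  have s: "s > 0" "s\<^sup>2 = 1 + a\<^sup>2" by (auto simp: s_def add_pos_nonneg)
  have t: "t > 0" "t\<^sup>2 = 1 + b\<^sup>2 + c\<^sup>2" by (auto simp: t_def add_pos_nonneg)
  have c: "?c > 0" "?c\<^sup>2 = 1 + c\<^sup>2" by (auto simp: add_pos_nonneg)
  have scale: "(e - a * b / s * x) / sqrt (?c\<^sup>2 + (b / s)\<^sup>2) = (e / t - ?r * x) / sqrt (1 - ?r\<^sup>2)" for x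
  proof -
    have bs: "b\<^sup>2 - b\<^sup>2 * a\<^sup>2 / s\<^sup>2 = b\<^sup>2 / s\<^sup>2"
    proof -
      have "b\<^sup>2 * s\<^sup>2 - b\<^sup>2 * a\<^sup>2 = b\<^sup>2" by (simp add: s(2) algebra_simps)
      then show ?thesis using s(1) by (simp add: field_simps)
    qed
    have "t\<^sup>2 * (1 - ?r\<^sup>2) = t\<^sup>2 - b\<^sup>2 * a\<^sup>2 / s\<^sup>2"
    proof -
      have "?r\<^sup>2 = (b\<^sup>2 * a\<^sup>2 / s\<^sup>2) / t\<^sup>2"
        by (simp add: power_divide power_mult_distrib mult.commute)
      then show ?thesis using t(1) by (simp add: right_diff_distrib)
    qed
    also have "\<dots> = ?c\<^sup>2 + (b / s)\<^sup>2"
      unfolding t(2) c(2) using bs by (simp add: power_divide)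
    finally have "sqrt (?c\<^sup>2 + (b / s)\<^sup>2) = t * sqrt (1 - ?r\<^sup>2)"
      using t by (metis real_sqrt_mult real_sqrt_abs abs_of_pos)
    moreover have "e - a * b / s * x = t * (e / t - ?r * x)"
      using t by (simp add: field_simps)
    ultimately show ?thesis using t by simp
  qed
  have "(\<integral>\<^sup>+z. \<integral>\<^sup>+y. ennreal (std_normal_cdf (d + a * z)) * ennreal (std_normal_cdf (e + b * z + c * y)) \<partial>N01 \<partial>N01)
      = (\<integral>\<^sup>+z. ennreal (std_normal_cdf (d + a * z)) * ennreal (std_normal_cdf ((e + b * z) / ?c)) \<partial>N01)"
    using std_normal_cdf_mixture[of 1] by (simp add: nn_integral_cmult)
  also have "\<dots> = (\<integral>\<^sup>+x. indicator {..d / s} x *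
      (\<integral>\<^sup>+w. ennreal (std_normal_cdf ((e + b * ((w - a * x) / s)) / ?c)) \<partial>N01) \<partial>N01)"
    unfolding s_def by (rule nn_integral_std_normal_cdf_affine) measurable
  also have "\<dots> = (\<integral>\<^sup>+x. indicator {..d / s} x *
      (\<integral>\<^sup>+w. ennreal (std_normal_cdf (((e - a * b / s * x) + b / s * w) / ?c)) \<partial>N01) \<partial>N01)"
    by (intro nn_integral_cong arg_cong2[where f = "(*)"] refl arg_cong[where f = "\<lambda>v. ennreal (std_normal_cdf (v / ?c))"])
       (simp add: algebra_simps diff_divide_distrib)
  also have "\<dots> = (\<integral>\<^sup>+x. indicator {..d / s} x *
      ennreal (std_normal_cdf ((e - a * b / s * x) / sqrt (?c\<^sup>2 + (b / s)\<^sup>2))) \<partial>N01)"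
    using c by (subst std_normal_cdf_mixture) auto
  finally show ?thesis unfolding orthant_prob_def scale .
qed

text \<open>
  Raising the correlation decreases the slope of the line \<open>x \<mapsto> (v - r x) / sqrt (1 - r\<^sup>2)\<close>, so the
  difference \<open>h\<close> of the two integrands is positive to the left of a single crossing point and negative
  to the right of it. The full integrals agree, since both are \<open>\<Phi>(v)\<close>. Hence an integral of \<open>h\<close> over
  a left half-line cannot vanish: either \<open>h\<close> has one sign there, or it has the other sign on the
  complementary half-line, where the integral would vanish too.
\<close>

lemma orthant_prob_neq:
  assumes r: "r1 < r2" "\<bar>r1\<bar> < 1" "\<bar>r2\<bar> < 1"
  shows "orthant_prob u v r1 \<noteq> orthant_prob u v r2"
proof
  assume eq: "orthant_prob u v r1 = orthant_prob u v r2"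
  interpret prob_space N01 by (rule prob_space_std_normal)
  let ?q = "\<lambda>r. sqrt (1 - r\<^sup>2)"
  define g where "g r x = std_normal_cdf ((v - r * x) / ?q r)" for r x
  have sq: "r\<^sup>2 < 1" if "\<bar>r\<bar> < 1" for r :: real
    using that by (simp add: abs_square_less_1)
  have q: "?q r > 0" if "\<bar>r\<bar> < 1" for r using sq[OF that] by simp
  have [measurable]: "g r \<in> borel_measurable borel" for r unfolding g_def by measurable
  have g01: "0 \<le> g r x" "g r x \<le> 1" for r x by (auto simp: g_def std_normal_cdf_range)
  have int: "integrable N01 (g r)" "integrable N01 (\<lambda>x. indicator X x * g r x)"
    if "X \<in> sets borel" for r X
    using g01 that by (auto intro!: integrable_const_bound[where B = 1] split: split_indicator simp: mult_le_one)
  have total: "(\<integral>x. g r x \<partial>N01) = std_normal_cdf v" if "\<bar>r\<bar> < 1" for r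
  proof -
    have "(\<integral>\<^sup>+x. ennreal (g r x) \<partial>N01) = ennreal (std_normal_cdf (v / sqrt ((?q r)\<^sup>2 + (-r)\<^sup>2)))"
      using std_normal_cdf_mixture[OF q[OF that], of v "-r"] by (simp add: g_def)
    also have "sqrt ((?q r)\<^sup>2 + (-r)\<^sup>2) = 1" using sq[OF that] by simp
    finally show ?thesis
      using g01 std_normal_cdf_range by (subst integral_eq_nn_integral) auto
  qed
  have lower: "(\<integral>x. indicator {..u} x * g r1 x \<partial>N01) = (\<integral>x. indicator {..u} x * g r2 x \<partial>N01)"
  proof -
    have "(\<integral>x. indicator {..u} x * g r x \<partial>N01) = enn2real (orthant_prob u v r)" for r
      using g01 unfolding orthant_prob_def
      by (subst integral_eq_nn_integral)
         (auto simp: g_def std_normal_cdf_range ennreal_mult' ennreal_indicator)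
    then show ?thesis using eq by simp
  qed
  have slope: "r1 / ?q r1 < r2 / ?q r2"
  proof -
    have pos: "x / ?q x < y / ?q y" if "0 \<le> x" "x < y" "y < 1" for x y
    proof (rule frac_less)
      have "x\<^sup>2 \<le> y\<^sup>2" using that by (intro power_mono) auto
      then show "?q y \<le> ?q x" by simp
    qed (use that q[of y] in auto)
    consider "0 \<le> r1" | "r1 < 0" "0 \<le> r2" | "r2 < 0" by linarith
    then show ?thesis
    proof cases
      case 2
      then have "r1 / ?q r1 < 0" "0 \<le> r2 / ?q r2"
        using q r by (auto intro!: divide_neg_pos divide_nonneg_pos simp del: real_sqrt_gt_0_iff)
      then show ?thesis by linarith
    qed (use pos[of r1 r2] pos[of "- r2" "- r1"] r in auto)
  qed
  define h where "h x = g r2 x - g r1 x" for x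
  \<comment> \<open>The crossing point of the two lines \<open>x \<mapsto> (v - r x) / sqrt (1 - r\<^sup>2)\<close>.\<close>
  define x0 where "x0 = (v / ?q r2 - v / ?q r1) / (r2 / ?q r2 - r1 / ?q r1)"
  have h_pos: "0 < h x \<longleftrightarrow> x < x0" and h_neg: "h x < 0 \<longleftrightarrow> x0 < x" for x
  proof -
    have split: "(v - r * x) / ?q r = v / ?q r - (r / ?q r) * x" for r by (simp add: diff_divide_distrib)
    have "0 < h x \<longleftrightarrow> (v - r1 * x) / ?q r1 < (v - r2 * x) / ?q r2"
      by (simp add: h_def g_def strict_mono_less[OF std_normal_cdf_strict_mono])
    also have "\<dots> \<longleftrightarrow> x < x0"
      unfolding split x0_def using slope by (subst pos_less_divide_eq) (auto simp: algebra_simps)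
    finally show "0 < h x \<longleftrightarrow> x < x0" .
    have "h x < 0 \<longleftrightarrow> (v - r2 * x) / ?q r2 < (v - r1 * x) / ?q r1"
      by (simp add: h_def g_def strict_mono_less[OF std_normal_cdf_strict_mono])
    also have "\<dots> \<longleftrightarrow> x0 < x"
      unfolding split x0_def using slope by (subst pos_divide_less_eq) (auto simp: algebra_simps)
    finally show "h x < 0 \<longleftrightarrow> x0 < x" .
  qed
  \<comment> \<open>A function of one sign, nonzero on an interval, cannot have integral zero; \<open>c\<close> is the sign.\<close>
  have vanish: False
    if "c \<in> {-1, 1 :: real}" "X \<in> sets borel" "(\<integral>x. indicator X x * (c * h x) \<partial>N01) = 0"
      "\<And>x. x \<in> X \<Longrightarrow> 0 \<le> c * h x" "a < b" "\<And>x. a < x \<Longrightarrow> x < b \<Longrightarrow> x \<in> X \<and> 0 < c * h x" for c X a b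
  proof -
    have [measurable]: "X \<in> sets borel" by fact
    have "integrable N01 (\<lambda>x. c * (indicator X x * g r2 x - indicator X x * g r1 x))"
      using int that(2) by (intro integrable_mult_right Bochner_Integration.integrable_diff) auto
    then have "integrable N01 (\<lambda>x. indicator X x * (c * h x))"
      by (simp add: h_def algebra_simps)
    then have "AE x in N01. indicator X x * (c * h x) = 0"
      using that by (subst integral_nonneg_eq_0_iff_AE[symmetric]) (auto split: split_indicator)
    then have "AE x in lborel. indicator X x * (c * h x) = 0"
      by (subst (asm) AE_density) (auto simp: normal_density_pos)
    then have "AE x in lborel. x \<notin> {a<..<b}"
      by eventually_elim (use that(6) in \<open>force split: split_indicator_asm\<close>)
    then have "emeasure lborel {a<..<b} = 0"
      by (subst (asm) AE_iff_measurable[where N = "{a<..<b}"]) auto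
    then show False using \<open>a < b\<close> by simp
  qed
  have zero_low: "(\<integral>x. indicator {..u} x * h x \<partial>N01) = 0"
    using lower int[of "{..u}"] by (simp add: h_def right_diff_distrib)
  show False
  proof (cases "u \<le> x0")
    case True
    show False
    proof (rule vanish[of 1 "{..u}" "u - 1" u])
      show "0 \<le> 1 * h x" if "x \<in> {..u}" for x
        using h_neg[of x] that True by force
      show "x \<in> {..u} \<and> 0 < 1 * h x" if "u - 1 < x" "x < u" for x
        using h_pos[of x] that True by force
    qed (use zero_low in auto)
  next
    case False
    have "(\<integral>x. h x \<partial>N01) = 0"
      using total r int[of UNIV] by (simp add: h_def)
    moreover have "(\<lambda>x. indicator {u<..} x * (-1 * h x)) = (\<lambda>x. indicator {..u} x * h x - h x)"
      by (auto simp: fun_eq_iff indicator_def)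
    moreover have "integrable N01 h" "integrable N01 (\<lambda>x. indicator {..u} x * h x)"
      using int[of UNIV] int[of "{..u}"] by (auto simp: h_def[abs_def] right_diff_distrib)
    ultimately have "(\<integral>x. indicator {u<..} x * (-1 * h x) \<partial>N01) = 0"
      using zero_low by simp
    then show False
    proof (rule vanish[of "-1" "{u<..}" u "u + 1", rotated 2])
      show "0 \<le> -1 * h x" if "x \<in> {u<..}" for x
        using h_pos[of x] that False by force
      show "x \<in> {u<..} \<and> 0 < -1 * h x" if "u < x" "x < u + 1" for x
        using h_neg[of x] that False by force
    qed auto
  qed
qed

section \<open>Two linear forms of a Gaussian vector\<close>

text \<open>
  One Gram-Schmidt step. If \<open>a\<close> already lies in the span of the family there is no
  residual to normalize, and any \<open>S\<close>-orthogonal direction serves; it exists since the family is too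
  small to span.
\<close>

lemma orthonormal_extend:
  fixes S :: "real^'n^'n" and w :: "'i \<Rightarrow> real^'n"
  assumes S: "sym_pos_def S" and K: "finite K" "card K < CARD('n)"
    and w: "\<And>i j. i \<in> K \<Longrightarrow> j \<in> K \<Longrightarrow> w i \<bullet> (S *v w j) = (if i = j then 1 else 0)"
  shows "\<exists>v. v \<bullet> (S *v v) = 1 \<and> (\<forall>i\<in>K. w i \<bullet> (S *v v) = 0)
    \<and> (\<exists>c \<gamma>. a = (\<Sum>i\<in>K. c i *\<^sub>R w i) + \<gamma> *\<^sub>R v)"
proof -
  have normalize: "\<exists>v q. v \<bullet> (S *v v) = 1 \<and> (\<forall>i\<in>K. w i \<bullet> (S *v v) = 0) \<and> r = q *\<^sub>R v"
    if r: "r \<noteq> 0" "\<And>i. i \<in> K \<Longrightarrow> w i \<bullet> (S *v r) = 0" for r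
  proof -
    let ?q = "sqrt (r \<bullet> (S *v r))"
    have pos: "0 < r \<bullet> (S *v r)" using S r(1) by (simp add: sym_pos_def_def)
    have "(1 / ?q) *\<^sub>R r \<bullet> (S *v ((1 / ?q) *\<^sub>R r)) = 1"
      using pos by (simp add: matrix_vector_mult_scaleR)
    moreover have "\<forall>i\<in>K. w i \<bullet> (S *v ((1 / ?q) *\<^sub>R r)) = 0"
      using r(2) by (simp add: matrix_vector_mult_scaleR)
    moreover have "r = ?q *\<^sub>R ((1 / ?q) *\<^sub>R r)" using pos by simp
    ultimately show ?thesis by blast
  qed
  define r where "r = a - (\<Sum>i\<in>K. (w i \<bullet> (S *v a)) *\<^sub>R w i)"
  have a: "a = (\<Sum>i\<in>K. (w i \<bullet> (S *v a)) *\<^sub>R w i) + r" by (simp add: r_def)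
  have r_orth: "w j \<bullet> (S *v r) = 0" if "j \<in> K" for j
  proof -
    have "w j \<bullet> (S *v r) = w j \<bullet> (S *v a) - (\<Sum>i\<in>K. (w i \<bullet> (S *v a)) * (w j \<bullet> (S *v w i)))"
      by (simp add: r_def matrix_vector_mult_diff_distrib inner_diff_right inner_sum_right
          linear_sum[OF matrix_vector_mul_linear] matrix_vector_mult_scaleR)
    also have "(\<Sum>i\<in>K. (w i \<bullet> (S *v a)) * (w j \<bullet> (S *v w i))) = w j \<bullet> (S *v a)"
      using that K w by (simp add: if_distrib[of "\<lambda>x. _ * x"] sum.delta cong: if_cong sum.cong)
    finally show ?thesis by simp
  qed
  show ?thesis
  proof (cases "r = 0")
    case False
    then obtain v q where "v \<bullet> (S *v v) = 1" "\<forall>i\<in>K. w i \<bullet> (S *v v) = 0" "r = q *\<^sub>R v"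
      using normalize r_orth by blast
    then show ?thesis
      using a by (intro exI[of _ v] conjI exI[of _ "\<lambda>i. w i \<bullet> (S *v a)"] exI[of _ q]) auto
  next
    case True
    have "dim ((\<lambda>i. S *v w i) ` K) < DIM(real^'n)"
      using dim_le_card'[of "(\<lambda>i. S *v w i) ` K"] card_image_le[OF K(1), of "\<lambda>i. S *v w i"] K by simp
    then obtain z where z: "z \<noteq> 0" "\<And>y. y \<in> span ((\<lambda>i. S *v w i) ` K) \<Longrightarrow> orthogonal z y"
      by (metis orthogonal_to_subspace_exists)
    have "w i \<bullet> (S *v z) = 0" if "i \<in> K" for i
      using z(2)[OF span_base, of "S *v w i"] that
      by (simp add: orthogonal_def sym_pos_def_inner_commute[OF S, of "w i"])
    then obtain v q where "v \<bullet> (S *v v) = 1" "\<forall>i\<in>K. w i \<bullet> (S *v v) = 0"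
      using normalize z(1) by blast
    moreover have "a = (\<Sum>i\<in>K. (w i \<bullet> (S *v a)) *\<^sub>R w i) + 0 *\<^sub>R v" using a True by simp
    ultimately show ?thesis
      by (intro exI[of _ v] conjI exI[of _ "\<lambda>i. w i \<bullet> (S *v a)"] exI[of _ 0]) auto
  qed
qed

text \<open>
  Gram-Schmidt started with \<open>a\<close> and \<open>b\<close> and continued to a basis. In the coordinates of this basis
  the forms given by \<open>a\<close> and \<open>b\<close> involve only one and two coordinates.
\<close>

lemma orthonormal_basis_through_two:
  fixes S :: "real^'n^'n"
  assumes S: "sym_pos_def S" and k: "k1 \<noteq> k2"
  obtains w :: "'n \<Rightarrow> real^'n" and \<alpha> \<beta> \<gamma> where
    "\<And>i j. w i \<bullet> (S *v w j) = (if i = j then 1 else 0)"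
    "a = \<alpha> *\<^sub>R w k1" "b = \<beta> *\<^sub>R w k1 + \<gamma> *\<^sub>R w k2"
proof -
  define orth where "orth K w \<longleftrightarrow>
    (\<forall>i\<in>K. \<forall>j\<in>K. w i \<bullet> (S *v w j) = (if i = j then 1 else 0))" for K and w :: "'n \<Rightarrow> real^'n"
  have step: "\<exists>v. orth (insert k K) (w(k := v)) \<and> (\<exists>c \<gamma>. a = (\<Sum>i\<in>K. c i *\<^sub>R w i) + \<gamma> *\<^sub>R v)"
    if "orth K w" "k \<notin> K" for K k w a
  proof -
    have "card K < CARD('n)" using that(2) by (intro psubset_card_mono) auto
    moreover have "w i \<bullet> (S *v w j) = (if i = j then 1 else 0)" if "i \<in> K" "j \<in> K" for i j
      using \<open>orth K w\<close> that by (simp add: orth_def)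
    ultimately obtain v where v: "v \<bullet> (S *v v) = 1" "\<forall>i\<in>K. w i \<bullet> (S *v v) = 0"
      and a: "\<exists>c \<gamma>. a = (\<Sum>i\<in>K. c i *\<^sub>R w i) + \<gamma> *\<^sub>R v"
      using orthonormal_extend[OF S finite[of K], of w a] by blast
    have v': "v \<bullet> (S *v w i) = 0" if "i \<in> K" for i
      using v(2) that by (subst sym_pos_def_inner_commute[OF S]) simp
    have "orth (insert k K) (w(k := v))"
      using that v v' unfolding orth_def by auto
    then show ?thesis using a by blast
  qed
  obtain v1 \<alpha> where 1: "orth {k1} ((\<lambda>_. 0)(k1 := v1))" "a = \<alpha> *\<^sub>R v1"
    using step[of "{}" "\<lambda>_. 0" k1 a] by (auto simp: orth_def)
  obtain v2 \<beta> \<gamma> where 2: "orth {k2, k1} ((\<lambda>_. 0)(k1 := v1, k2 := v2))" "b = \<beta> *\<^sub>R v1 + \<gamma> *\<^sub>R v2"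
    using step[OF 1(1), of k2 b] k by auto
  have "\<exists>w. orth ({k2, k1} \<union> K) w \<and> w k1 = v1 \<and> w k2 = v2" if "finite K" for K
    using that
  proof induction
    case empty
    show ?case using 2(1) k by (intro exI[of _ "(\<lambda>_. 0)(k1 := v1, k2 := v2)"]) (simp del: fun_upd_apply, simp)
  next
    case (insert k K)
    then obtain w where w: "orth ({k2, k1} \<union> K) w" "w k1 = v1" "w k2 = v2" by blast
    show ?case
    proof (cases "k \<in> {k2, k1}")
      case True
      then have "{k2, k1} \<union> insert k K = {k2, k1} \<union> K" by auto
      then show ?thesis using w by metis
    next
      case False
      then obtain v where "orth (insert k ({k2, k1} \<union> K)) (w(k := v))"
        using step[OF w(1), of k] insert by auto
      moreover have "insert k ({k2, k1} \<union> K) = {k2, k1} \<union> insert k K" by auto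
      moreover have "(w(k := v)) k1 = v1" "(w(k := v)) k2 = v2" using w False by auto
      ultimately show ?thesis by metis
    qed
  qed
  from this[of UNIV] obtain w where "orth UNIV w" "w k1 = v1" "w k2 = v2" by auto
  then show thesis using that[of w \<alpha> \<beta> \<gamma>] 1(2) 2(2) by (auto simp: orth_def)
qed

lemma nn_integral_lborel_shift:
  fixes f :: "'a::euclidean_space \<Rightarrow> ennreal"
  assumes [measurable]: "f \<in> borel_measurable borel"
  shows "(\<integral>\<^sup>+x. f (t + x) \<partial>lborel) = (\<integral>\<^sup>+x. f x \<partial>lborel)"
    and "(\<integral>\<^sup>+x. f (t - x) \<partial>lborel) = (\<integral>\<^sup>+x. f x \<partial>lborel)"
proof -
  have "(\<integral>\<^sup>+x. f x \<partial>lborel) = (\<integral>\<^sup>+x. f (t + c *\<^sub>R x) \<partial>lborel)" if "\<bar>c\<bar> = 1" for c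
    using that by (subst lborel_affine[of c t]) (auto simp: nn_integral_density nn_integral_distr)
  from this[of 1] this[of "-1"]
  show "(\<integral>\<^sup>+x. f (t + x) \<partial>lborel) = (\<integral>\<^sup>+x. f x \<partial>lborel)"
    "(\<integral>\<^sup>+x. f (t - x) \<partial>lborel) = (\<integral>\<^sup>+x. f x \<partial>lborel)" by auto
qed

text \<open>
  The image of Lebesgue measure under a linear bijection is translation invariant, so it is a multiple
  of Lebesgue measure. The proof is the uniqueness argument for Haar measure: by Fubini and
  invariance, \<open>f(T x) g(y)\<close> may be replaced by \<open>f(T x) g(T x + y)\<close>, then by \<open>f(T x - y) g(T x)\<close>.
  Stating it with two functions avoids naming the factor, a determinant.
\<close>

lemma nn_integral_linear_change:
  fixes f g :: "'a::euclidean_space \<Rightarrow> ennreal" and T R :: "'a \<Rightarrow> 'a"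
  assumes T: "linear T" and R: "\<And>y. T (R y) = y"
    and f[measurable]: "f \<in> borel_measurable borel" and g[measurable]: "g \<in> borel_measurable borel"
  shows "(\<integral>\<^sup>+x. f (T x) \<partial>lborel) * (\<integral>\<^sup>+x. g x \<partial>lborel) = (\<integral>\<^sup>+x. g (T x) \<partial>lborel) * (\<integral>\<^sup>+x. f x \<partial>lborel)"
proof -
  have [measurable]: "T \<in> borel_measurable borel"
    using T by (intro borel_measurable_continuous_onI linear_continuous_on linear_conv_bounded_linear[THEN iffD1])
  have "(\<integral>\<^sup>+x. f (T x) \<partial>lborel) * (\<integral>\<^sup>+x. g x \<partial>lborel) = (\<integral>\<^sup>+x. \<integral>\<^sup>+y. f (T x) * g (T x + y) \<partial>lborel \<partial>lborel)"
    by (simp add: nn_integral_cmult nn_integral_multc nn_integral_lborel_shift)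
  also have "\<dots> = (\<integral>\<^sup>+y. \<integral>\<^sup>+x. f (T x) * g (T x + y) \<partial>lborel \<partial>lborel)"
    by (rule lborel_pair.Fubini'[symmetric]) measurable
  also have "\<dots> = (\<integral>\<^sup>+y. \<integral>\<^sup>+x. f (T x - y) * g (T x) \<partial>lborel \<partial>lborel)"
  proof (rule nn_integral_cong)
    fix y
    have "(\<integral>\<^sup>+x. f (T x - y) * g (T x) \<partial>lborel) = (\<integral>\<^sup>+x. f (T (R y + x) - y) * g (T (R y + x)) \<partial>lborel)"
      by (rule nn_integral_lborel_shift(1)[symmetric]) measurable
    then show "(\<integral>\<^sup>+x. f (T x) * g (T x + y) \<partial>lborel) = (\<integral>\<^sup>+x. f (T x - y) * g (T x) \<partial>lborel)"
      by (simp add: linear_add[OF T] R add.commute)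
  qed
  also have "\<dots> = (\<integral>\<^sup>+x. \<integral>\<^sup>+y. f (T x - y) * g (T x) \<partial>lborel \<partial>lborel)"
    by (rule lborel_pair.Fubini') measurable
  also have "\<dots> = (\<integral>\<^sup>+x. g (T x) \<partial>lborel) * (\<integral>\<^sup>+x. f x \<partial>lborel)"
    by (simp add: nn_integral_cmult nn_integral_multc nn_integral_lborel_shift mult.commute)
  finally show ?thesis .
qed

definition std_gauss :: "'a::euclidean_space \<Rightarrow> real" where
  "std_gauss x = (\<Prod>b\<in>Basis. std_normal_density (x \<bullet> b))"

lemma std_gauss_measurable [measurable]: "std_gauss \<in> borel_measurable borel"
  unfolding std_gauss_def by measurable

lemma std_gauss_pos: "0 < std_gauss x"
  by (simp add: std_gauss_def prod_pos normal_density_pos)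

lemma std_gauss_exp:
  "std_gauss (x :: 'a::euclidean_space) = exp (- (x \<bullet> x) / 2) / sqrt (2 * pi) ^ DIM('a)"
proof -
  have "x \<bullet> x = (\<Sum>b\<in>Basis. (x \<bullet> b)\<^sup>2)" by (subst euclidean_inner) (simp add: power2_eq_square)
  then have "- (x \<bullet> x) / 2 = (\<Sum>b\<in>Basis. - (x \<bullet> b)\<^sup>2 / 2)"
    by (simp add: sum_negf sum_divide_distrib)
  then show ?thesis
    by (simp add: std_gauss_def std_normal_density_def exp_sum prod_dividef)
qed

text \<open>
  The coordinates of a standard Gaussian vector are independent standard normal variables, and all but
  two of them are integrated out.
\<close>

lemma nn_integral_std_gauss_two_coords:
  fixes e1 e2 :: "'a::euclidean_space" and F :: "real \<times> real \<Rightarrow> ennreal"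
  assumes e: "e1 \<in> Basis" "e2 \<in> Basis" "e1 \<noteq> e2"
    and F[measurable]: "F \<in> borel_measurable (borel \<Otimes>\<^sub>M borel)"
  shows "(\<integral>\<^sup>+x. ennreal (std_gauss (x::'a)) * F (x \<bullet> e1, x \<bullet> e2) \<partial>lborel) = (\<integral>\<^sup>+x. \<integral>\<^sup>+y. F (x, y) \<partial>N01 \<partial>N01)"
proof -
  interpret product_sigma_finite "\<lambda>_::'a. lborel :: real measure" ..
  let ?p = "\<lambda>x. ennreal (std_normal_density x)"
  have p1: "(\<integral>\<^sup>+x. ?p x \<partial>lborel) = 1"
    using nn_integral_std_normal[of "\<lambda>_. 1"] prob_space.emeasure_space_1[OF prob_space_std_normal] by simp
  have coord: "(\<Sum>c\<in>Basis. f c *\<^sub>R c) \<bullet> b = f b" if "b \<in> Basis" for f and b :: 'a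
    using that by (rule inner_sum_left_Basis)
  obtain C :: "'a set" where B: "Basis = insert e1 (insert e2 C)"
    and C: "finite C" "e1 \<notin> insert e2 C" "e2 \<notin> C"
  proof (rule that[of "Basis - {e1, e2}"])
    show "Basis = insert e1 (insert e2 (Basis - {e1, e2}))" using e(1,2) by blast
    show "e1 \<notin> insert e2 (Basis - {e1, e2})" using e(3) by blast
  qed auto
  have split_prod: "(\<Prod>b\<in>Basis. ?p (f b)) * F (f e1, f e2)
      = (?p (f e1) * F (f e1, f e2) * ?p (f e2)) * (\<Prod>b\<in>C. ?p (f b))" for f :: "'a \<Rightarrow> real"
    using C by (simp add: B mult_ac)
  have two: "(\<integral>\<^sup>+f. h f \<partial>(\<Pi>\<^sub>M b\<in>insert e1 (insert e2 C). lborel))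
      = (\<integral>\<^sup>+x. \<integral>\<^sup>+y. \<integral>\<^sup>+f. h (f(e2 := y, e1 := x)) \<partial>(\<Pi>\<^sub>M b\<in>C. lborel) \<partial>lborel \<partial>lborel)"
    if h: "h \<in> borel_measurable (\<Pi>\<^sub>M b\<in>insert e1 (insert e2 C). lborel)" for h :: "('a \<Rightarrow> real) \<Rightarrow> ennreal"
  proof -
    have "(\<integral>\<^sup>+f. h f \<partial>(\<Pi>\<^sub>M b\<in>insert e1 (insert e2 C). lborel))
        = (\<integral>\<^sup>+x. \<integral>\<^sup>+f. h (f(e1 := x)) \<partial>(\<Pi>\<^sub>M b\<in>insert e2 C. lborel) \<partial>lborel)"
      using product_nn_integral_insert_rev[of "insert e2 C" e1 h] C h by simp
    also have "\<dots> = (\<integral>\<^sup>+x. \<integral>\<^sup>+y. \<integral>\<^sup>+f. h (f(e2 := y, e1 := x)) \<partial>(\<Pi>\<^sub>M b\<in>C. lborel) \<partial>lborel \<partial>lborel)"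
    proof (rule nn_integral_cong)
      fix x
      have "(\<lambda>f. h (f(e1 := x))) \<in> borel_measurable (\<Pi>\<^sub>M b\<in>insert e2 C. lborel)"
        by (rule measurable_compose[OF measurable_fun_upd[where J = "insert e2 C"] h]) auto
      then show "(\<integral>\<^sup>+f. h (f(e1 := x)) \<partial>(\<Pi>\<^sub>M b\<in>insert e2 C. lborel))
          = (\<integral>\<^sup>+y. \<integral>\<^sup>+f. h (f(e2 := y, e1 := x)) \<partial>(\<Pi>\<^sub>M b\<in>C. lborel) \<partial>lborel)"
        using product_nn_integral_insert_rev[of C e2 "\<lambda>f. h (f(e1 := x))"] C by simp
    qed
    finally show ?thesis .
  qed
  have "(\<integral>\<^sup>+x. ennreal (std_gauss (x::'a)) * F (x \<bullet> e1, x \<bullet> e2) \<partial>lborel)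
      = (\<integral>\<^sup>+f. (\<Prod>b\<in>Basis. ?p (f b)) * F (f e1, f e2) \<partial>(\<Pi>\<^sub>M b\<in>Basis. lborel))"
  proof -
    have "ennreal (std_gauss x) = (\<Prod>b\<in>Basis. ?p (x \<bullet> b))" for x :: 'a
      by (simp only: std_gauss_def prod_ennreal normal_density_nonneg)
    then have "(\<integral>\<^sup>+x. ennreal (std_gauss (x::'a)) * F (x \<bullet> e1, x \<bullet> e2) \<partial>lborel)
        = (\<integral>\<^sup>+x. (\<Prod>b\<in>Basis. ?p (x \<bullet> b)) * F (x \<bullet> e1, x \<bullet> e2)
            \<partial>(distr (\<Pi>\<^sub>M b\<in>Basis. lborel) borel (\<lambda>f. \<Sum>b\<in>Basis. f b *\<^sub>R b)))"
      by (simp only: lborel_eq[symmetric])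
    also have "\<dots> = (\<integral>\<^sup>+f. (\<Prod>b\<in>Basis. ?p ((\<Sum>c\<in>Basis. f c *\<^sub>R c) \<bullet> b))
          * F ((\<Sum>c\<in>Basis. f c *\<^sub>R c) \<bullet> e1, (\<Sum>c\<in>Basis. f c *\<^sub>R c) \<bullet> e2) \<partial>(\<Pi>\<^sub>M b\<in>Basis. lborel))"
      by (rule nn_integral_distr) measurable
    finally show ?thesis using e by (simp only: coord cong: prod.cong)
  qed
  also have "\<dots> = (\<integral>\<^sup>+x. \<integral>\<^sup>+y. \<integral>\<^sup>+f. (?p x * F (x, y) * ?p y) * (\<Prod>b\<in>C. ?p (f b)) \<partial>(\<Pi>\<^sub>M b\<in>C. lborel) \<partial>lborel \<partial>lborel)"
  proof -
    let ?h = "\<lambda>f. (?p (f e1) * F (f e1, f e2) * ?p (f e2)) * (\<Prod>b\<in>C. ?p (f b))"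
    have "?h \<in> borel_measurable (\<Pi>\<^sub>M b\<in>insert e1 (insert e2 C). lborel)" by measurable
    note two[OF this]
    moreover have "?h (f(e2 := y, e1 := x)) = (?p x * F (x, y) * ?p y) * (\<Prod>b\<in>C. ?p (f b))" for f x y
    proof -
      have "(\<Prod>b\<in>C. ?p ((f(e2 := y, e1 := x)) b)) = (\<Prod>b\<in>C. ?p (f b))"
        by (rule prod.cong) (use C in auto)
      moreover have "(f(e2 := y, e1 := x)) e1 = x" "(f(e2 := y, e1 := x)) e2 = y" using e by auto
      ultimately show ?thesis by (simp only:)
    qed
    ultimately have "(\<integral>\<^sup>+f. ?h f \<partial>(\<Pi>\<^sub>M b\<in>insert e1 (insert e2 C). lborel))
        = (\<integral>\<^sup>+x. \<integral>\<^sup>+y. \<integral>\<^sup>+f. (?p x * F (x, y) * ?p y) * (\<Prod>b\<in>C. ?p (f b)) \<partial>(\<Pi>\<^sub>M b\<in>C. lborel) \<partial>lborel \<partial>lborel)"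
      by (simp only:)
    then show ?thesis unfolding split_prod unfolding B .
  qed
  also have "\<dots> = (\<integral>\<^sup>+x. \<integral>\<^sup>+y. ?p x * F (x, y) * ?p y \<partial>lborel \<partial>lborel)"
  proof -
    have "(\<integral>\<^sup>+f. (\<Prod>b\<in>C. ?p (f b)) \<partial>(\<Pi>\<^sub>M b\<in>C. lborel)) = (\<Prod>b\<in>C. \<integral>\<^sup>+x. ?p x \<partial>lborel)"
      by (rule product_nn_integral_prod[OF C(1)]) simp
    then have one: "(\<integral>\<^sup>+f. (\<Prod>b\<in>C. ?p (f b)) \<partial>(\<Pi>\<^sub>M b\<in>C. lborel)) = 1"
      by (simp only: p1 prod.neutral_const)
    have "(\<lambda>f. \<Prod>b\<in>C. ?p (f b)) \<in> borel_measurable (\<Pi>\<^sub>M b\<in>C. lborel)" by measurable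
    from nn_integral_cmult[OF this] show ?thesis by (simp only: one mult_1_right)
  qed
  also have "\<dots> = (\<integral>\<^sup>+x. ?p x * (\<integral>\<^sup>+y. F (x, y) \<partial>N01) \<partial>lborel)"
  proof (rule nn_integral_cong)
    fix x
    have "(\<integral>\<^sup>+y. F (x, y) \<partial>N01) = (\<integral>\<^sup>+y. ?p y * F (x, y) \<partial>lborel)"
      by (rule nn_integral_std_normal) measurable
    moreover have "(\<integral>\<^sup>+y. ?p x * (?p y * F (x, y)) \<partial>lborel) = ?p x * (\<integral>\<^sup>+y. ?p y * F (x, y) \<partial>lborel)"
      by (rule nn_integral_cmult) measurable
    ultimately show "(\<integral>\<^sup>+y. ?p x * F (x, y) * ?p y \<partial>lborel) = ?p x * (\<integral>\<^sup>+y. F (x, y) \<partial>N01)"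
      by (simp only: mult_ac)
  qed
  also have "\<dots> = (\<integral>\<^sup>+x. \<integral>\<^sup>+y. F (x, y) \<partial>N01 \<partial>N01)"
  proof (rule nn_integral_std_normal[symmetric])
    interpret prob_space N01 by (rule prob_space_std_normal)
    show "(\<lambda>x. \<integral>\<^sup>+y. F (x, y) \<partial>N01) \<in> borel_measurable borel" by measurable
  qed
  finally show ?thesis .
qed

text \<open>
  The hypothesis says \<open>W S W\<^sup>T = 1\<close>, hence \<open>S\<^sup>-\<^sup>1 = W\<^sup>T W\<close>: in the coordinates \<open>W x\<close> the density of
  \<open>N(0, S)\<close> is standard Gaussian up to a constant.
\<close>

lemma orthonormal_rows_diagonalize:
  fixes S :: "real^'n^'n" and w :: "'n \<Rightarrow> real^'n"
  assumes w: "\<And>i j. w i \<bullet> (S *v w j) = (if i = j then 1 else 0)"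
  defines "W \<equiv> (\<chi> i. w i)"
  shows "0 < det S" and "x \<bullet> (matrix_inv S *v x) = (W *v x) \<bullet> (W *v x)" and "invertible W"
proof -
  have WSW: "W ** (S ** transpose W) = mat 1"
  proof -
    have "(W ** (S ** transpose W)) $ i $ j = w i \<bullet> (S *v w j)" for i j
      by (simp add: W_def matrix_matrix_mult_def matrix_vector_mult_def transpose_def inner_vec_def)
    then show ?thesis by (simp add: vec_eq_iff w mat_def)
  qed
  then have "det W * (det S * det W) = 1"
    by (metis det_I det_mul det_transpose)
  then have "det S * (det W)\<^sup>2 = 1" by (simp add: power2_eq_square mult_ac)
  then show "0 < det S"
    by (metis zero_less_mult_pos2 zero_less_one zero_less_power2 mult_zero_right power_zero_numeral zero_neq_one)
  have W': "(S ** transpose W) ** W = mat 1"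
    using WSW matrix_left_right_inverse by blast
  then show "invertible W" using WSW unfolding invertible_def by blast
  have "S ** (transpose W ** W) = mat 1" using W' by (simp add: matrix_mul_assoc)
  moreover from this have "invertible S"
    using matrix_left_right_inverse unfolding invertible_def by blast
  then have "matrix_inv S ** S = mat 1"
    unfolding invertible_def matrix_inv_def by (rule someI2_ex) simp
  ultimately have "matrix_inv S = transpose W ** W"
    by (metis matrix_mul_assoc matrix_mul_lid matrix_mul_rid)
  then show "x \<bullet> (matrix_inv S *v x) = (W *v x) \<bullet> (W *v x)"
    by (simp only: matrix_vector_mul_assoc[symmetric] matrix_vector_inner_transpose[of x "transpose W"]
        transpose_transpose)
qed

lemma std_gauss_mass: "(\<integral>\<^sup>+x. ennreal (std_gauss (x :: real^'n)) \<partial>lborel) = 1"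
  if "(k1 :: 'n) \<noteq> k2"
proof -
  have "(\<integral>\<^sup>+x. ennreal (std_gauss (x :: real^'n)) * 1 \<partial>lborel) = (\<integral>\<^sup>+x. \<integral>\<^sup>+y. 1 \<partial>N01 \<partial>N01)"
    by (rule nn_integral_std_gauss_two_coords[of "axis k1 1" "axis k2 1" "\<lambda>_. 1"])
       (use that in \<open>auto simp: axis_eq_axis\<close>)
  then show ?thesis using prob_space.emeasure_space_1[OF prob_space_std_normal] by simp
qed

text \<open>
  In the coordinates of an \<open>S\<close>-orthonormal basis through \<open>a\<close> and \<open>b\<close>, the vector is a multiple of a
  standard Gaussian vector and \<open>a \<bullet> \<eta>\<close>, \<open>b \<bullet> \<eta>\<close> are \<open>\<alpha> x\<close> and \<open>\<beta> x + \<gamma> y\<close>. The total mass of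
  \<open>N(0, S)\<close> is kept as a factor: that it is positive and finite is all that is needed, because it is
  also the total mass of the response distribution and cancels when two parameters are compared.
\<close>

lemma centred_normal_two_forms:
  fixes S :: "real^'n^'n" and a b :: "real^'n"
  assumes S: "sym_pos_def S" and k: "(k1 :: 'n) \<noteq> k2"
  defines "mass \<equiv> emeasure (centred_normal S) UNIV"
  obtains \<alpha> \<beta> \<gamma> where
    "0 < mass" "mass < \<infinity>"
    "a \<bullet> (S *v a) = \<alpha>\<^sup>2" "a \<bullet> (S *v b) = \<alpha> * \<beta>" "b \<bullet> (S *v b) = \<beta>\<^sup>2 + \<gamma>\<^sup>2"
    "\<And>F :: real \<times> real \<Rightarrow> ennreal. F \<in> borel_measurable (borel \<Otimes>\<^sub>M borel) \<Longrightarrow>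
      (\<integral>\<^sup>+\<eta>. F (a \<bullet> \<eta>, b \<bullet> \<eta>) \<partial>centred_normal S)
      = mass * (\<integral>\<^sup>+x. \<integral>\<^sup>+y. F (\<alpha> * x, \<beta> * x + \<gamma> * y) \<partial>N01 \<partial>N01)"
proof -
  obtain w \<alpha> \<beta> \<gamma> where w: "\<And>i j. w i \<bullet> (S *v w j) = (if i = j then 1 else 0)"
    and a: "a = \<alpha> *\<^sub>R w k1" and b: "b = \<beta> *\<^sub>R w k1 + \<gamma> *\<^sub>R w k2"
    using orthonormal_basis_through_two[OF S k] by metis
  define W :: "real^'n^'n" where "W = (\<chi> i. w i)"
  note W = orthonormal_rows_diagonalize[OF w, folded W_def]
  obtain R where R: "W *v (R y) = y" for y
  proof -
    obtain V where "W ** V = mat 1" using W(3) by (auto simp: invertible_def)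
    then have "W *v (V *v y) = y" for y by (simp add: matrix_vector_mul_assoc)
    then show thesis by (rule that)
  qed
  have inj: "W *v x = W *v y \<Longrightarrow> x = y" for x y
    using W(3) by (metis invertible_def matrix_vector_mul_assoc matrix_vector_mul_lid)
  have [measurable]: "(*v) W \<in> borel_measurable borel"
    by (intro borel_measurable_continuous_onI matrix_vector_mult_linear_continuous_on)
  have [measurable]: "(\<lambda>x :: real^'n. x $ i) \<in> borel_measurable borel" for i
    by (intro borel_measurable_continuous_onI continuous_intros)
  have coord: "(W *v \<eta>) $ i = w i \<bullet> \<eta>" for \<eta> i
    by (simp add: W_def matrix_vector_mult_def inner_vec_def)
  let ?\<gamma> = "\<lambda>x :: real^'n. ennreal (std_gauss x)"
  define K where "K = sqrt (2 * pi) ^ CARD('n) / sqrt ((2 * pi) ^ CARD('n) * det S)"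
  have K: "0 < K" using W(1) by (simp add: K_def)
  have dens: "exp (- (x \<bullet> (matrix_inv S *v x)) / 2) / sqrt ((2 * pi) ^ CARD('n) * det S)
      = K * std_gauss (W *v x)" for x
    by (simp add: std_gauss_exp W(2) K_def)
  have N: "(\<integral>\<^sup>+\<eta>. h (W *v \<eta>) \<partial>centred_normal S) = ennreal K * (\<integral>\<^sup>+\<eta>. ?\<gamma> (W *v \<eta>) * h (W *v \<eta>) \<partial>lborel)"
    if [measurable]: "h \<in> borel_measurable borel" for h
  proof -
    have "(\<integral>\<^sup>+\<eta>. h (W *v \<eta>) \<partial>centred_normal S)
        = (\<integral>\<^sup>+\<eta>. ennreal (K * std_gauss (W *v \<eta>)) * h (W *v \<eta>) \<partial>lborel)"
      unfolding centred_normal_def dens by (rule nn_integral_density) measurable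
    also have "\<dots> = (\<integral>\<^sup>+\<eta>. ennreal K * (?\<gamma> (W *v \<eta>) * h (W *v \<eta>)) \<partial>lborel)"
      using K by (simp add: ennreal_mult' mult_ac)
    also have "\<dots> = ennreal K * (\<integral>\<^sup>+\<eta>. ?\<gamma> (W *v \<eta>) * h (W *v \<eta>) \<partial>lborel)"
      by (rule nn_integral_cmult) measurable
    finally show ?thesis .
  qed
  \<comment> \<open>\<open>\<kappa>\<close> is the factor \<open>1 / \<bar>det W\<bar>\<close> of the change of variables. It is finite because
    the preimage of the unit cube is bounded.\<close>
  define \<kappa> where "\<kappa> = (\<integral>\<^sup>+\<eta>. ?\<gamma> (W *v \<eta>) \<partial>lborel)"
  have change: "(\<integral>\<^sup>+\<eta>. h (W *v \<eta>) \<partial>lborel) = \<kappa> * (\<integral>\<^sup>+x. h x \<partial>lborel)"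
    if [measurable]: "h \<in> borel_measurable borel" for h
    using nn_integral_linear_change[of "(*v) W" R h ?\<gamma>] R std_gauss_mass[OF k]
    by (simp add: \<kappa>_def)
  have "\<kappa> \<noteq> 0"
  proof
    assume "\<kappa> = 0"
    then have "AE \<eta> in lborel. ?\<gamma> (W *v \<eta>) = 0"
      unfolding \<kappa>_def by (subst (asm) nn_integral_0_iff_AE) auto
    moreover have "?\<gamma> x \<noteq> 0" for x
      using std_gauss_pos[of x] by (simp add: ennreal_eq_0_iff)
    ultimately have "AE \<eta> in lborel. (\<eta> :: real^'n) \<notin> UNIV" by simp
    then have "emeasure lborel (UNIV :: (real^'n) set) = 0"
      by (subst (asm) AE_iff_measurable[where N = UNIV]) auto
    then show False by simp
  qed
  moreover have "\<kappa> < \<infinity>"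
  proof -
    let ?B = "box 0 One :: (real^'n) set"
    have "\<kappa> = \<kappa> * emeasure lborel ?B"
      by (subst emeasure_lborel_box) auto
    also have "\<dots> = (\<integral>\<^sup>+\<eta>. indicator ?B (W *v \<eta>) \<partial>lborel)"
      by (subst change) auto
    also have "\<dots> = (\<integral>\<^sup>+\<eta>. indicator ((*v) W -` ?B) \<eta> \<partial>lborel)"
      by (intro nn_integral_cong) (auto split: split_indicator)
    also have "\<dots> = emeasure lborel ((*v) W -` ?B)"
    proof (rule nn_integral_indicator)
      show "(*v) W -` ?B \<in> sets lborel"
        using measurable_sets[of "(*v) W" borel borel ?B] by simp
    qed
    also have "\<dots> < \<infinity>"
    proof (rule emeasure_bounded_finite)
      obtain V where V: "V ** W = mat 1" using W(3) by (auto simp: invertible_def)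
      have "(*v) W -` ?B \<subseteq> (*v) V ` ?B"
      proof
        fix x assume "x \<in> (*v) W -` ?B"
        moreover have "x = V *v (W *v x)" by (simp add: matrix_vector_mul_assoc V)
        ultimately show "x \<in> (*v) V ` ?B" by blast
      qed
      then show "bounded ((*v) W -` ?B)"
        by (rule bounded_subset[rotated])
           (intro bounded_linear_image bounded_box matrix_vector_mul_bounded_linear)
    qed
    finally show ?thesis .
  qed
  moreover have mass: "mass = ennreal K * \<kappa>"
    using N[of "\<lambda>_. 1"] by (simp add: mass_def \<kappa>_def centred_normal_def)
  ultimately have "0 < mass" "mass < \<infinity>"
    using K by (auto simp: ennreal_zero_less_mult_iff zero_less_iff_neq_zero ennreal_mult_less_top)
  moreover have "a \<bullet> (S *v a) = \<alpha>\<^sup>2" "a \<bullet> (S *v b) = \<alpha> * \<beta>" "b \<bullet> (S *v b) = \<beta>\<^sup>2 + \<gamma>\<^sup>2"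
    using k by (auto simp: a b matrix_vector_right_distrib matrix_vector_mult_scaleR inner_add_left
        inner_add_right w power2_eq_square)
  moreover have "(\<integral>\<^sup>+\<eta>. F (a \<bullet> \<eta>, b \<bullet> \<eta>) \<partial>centred_normal S)
      = mass * (\<integral>\<^sup>+x. \<integral>\<^sup>+y. F (\<alpha> * x, \<beta> * x + \<gamma> * y) \<partial>N01 \<partial>N01)"
    if [measurable]: "F \<in> borel_measurable (borel \<Otimes>\<^sub>M borel)" for F :: "real \<times> real \<Rightarrow> ennreal"
  proof -
    let ?h = "\<lambda>x :: real^'n. F (\<alpha> * x $ k1, \<beta> * x $ k1 + \<gamma> * x $ k2)"
    have "(\<integral>\<^sup>+\<eta>. F (a \<bullet> \<eta>, b \<bullet> \<eta>) \<partial>centred_normal S) = (\<integral>\<^sup>+\<eta>. ?h (W *v \<eta>) \<partial>centred_normal S)"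
      by (simp add: coord a b inner_add_left)
    also have "\<dots> = ennreal K * (\<integral>\<^sup>+\<eta>. ?\<gamma> (W *v \<eta>) * ?h (W *v \<eta>) \<partial>lborel)"
      by (rule N) measurable
    also have "\<dots> = mass * (\<integral>\<^sup>+x. ?\<gamma> x * ?h x \<partial>lborel)"
      by (subst change[of "\<lambda>x. ?\<gamma> x * ?h x"], measurable) (simp add: mass mult.assoc)
    also have "(\<integral>\<^sup>+x. ?\<gamma> x * ?h x \<partial>lborel) = (\<integral>\<^sup>+x. \<integral>\<^sup>+y. F (\<alpha> * x, \<beta> * x + \<gamma> * y) \<partial>N01 \<partial>N01)"
      using nn_integral_std_gauss_two_coords[of "axis k1 1 :: real^'n" "axis k2 1" "\<lambda>(x, y). F (\<alpha> * x, \<beta> * x + \<gamma> * y)"] k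
      by (simp add: inner_axis axis_eq_axis split_beta)
    finally show ?thesis .
  qed
  ultimately show thesis by (rule that)
qed

section \<open>What two probit responses reveal\<close>

lemma centred_normal_probit_probs:
  fixes S :: "real^'n^'n" and a b :: "real^'n"
  assumes S: "sym_pos_def S" and k: "(k1 :: 'n) \<noteq> k2"
  defines "mass \<equiv> emeasure (centred_normal S) UNIV"
    and "\<rho> \<equiv> a \<bullet> (S *v b) / (sqrt (1 + a \<bullet> (S *v a)) * sqrt (1 + b \<bullet> (S *v b)))"
  shows "0 < mass" "mass < \<infinity>" "\<bar>\<rho>\<bar> < 1"
    and "(\<integral>\<^sup>+\<eta>. ennreal (std_normal_cdf (d + a \<bullet> \<eta>)) \<partial>centred_normal S)
      = mass * ennreal (std_normal_cdf (d / sqrt (1 + a \<bullet> (S *v a))))"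
    and "(\<integral>\<^sup>+\<eta>. ennreal (std_normal_cdf (d + a \<bullet> \<eta>)) * ennreal (std_normal_cdf (e + b \<bullet> \<eta>)) \<partial>centred_normal S)
      = mass * orthant_prob (d / sqrt (1 + a \<bullet> (S *v a))) (e / sqrt (1 + b \<bullet> (S *v b))) \<rho>"
proof -
  obtain \<alpha> \<beta> \<gamma> where m: "0 < mass" "mass < \<infinity>"
    and cov: "a \<bullet> (S *v a) = \<alpha>\<^sup>2" "a \<bullet> (S *v b) = \<alpha> * \<beta>" "b \<bullet> (S *v b) = \<beta>\<^sup>2 + \<gamma>\<^sup>2"
    and F: "\<And>F :: real \<times> real \<Rightarrow> ennreal. F \<in> borel_measurable (borel \<Otimes>\<^sub>M borel) \<Longrightarrow>
      (\<integral>\<^sup>+\<eta>. F (a \<bullet> \<eta>, b \<bullet> \<eta>) \<partial>centred_normal S)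
      = mass * (\<integral>\<^sup>+x. \<integral>\<^sup>+y. F (\<alpha> * x, \<beta> * x + \<gamma> * y) \<partial>N01 \<partial>N01)"
    using centred_normal_two_forms[OF S k, of a b] unfolding mass_def by blast
  show "0 < mass" "mass < \<infinity>" by fact+
  let ?s = "sqrt (1 + \<alpha>\<^sup>2)" and ?t = "sqrt (1 + \<beta>\<^sup>2 + \<gamma>\<^sup>2)"
  have st: "0 < ?s" "0 < ?t" by (auto simp: add_pos_nonneg)
  have \<rho>: "\<rho> = \<alpha> * \<beta> / (?s * ?t)" by (simp add: \<rho>_def cov add.assoc)
  have "\<bar>\<alpha>\<bar> < ?s" "\<bar>\<beta>\<bar> < ?t" by (auto intro!: real_less_rsqrt simp: add_pos_nonneg)
  then have "\<bar>\<alpha>\<bar> * \<bar>\<beta>\<bar> < ?s * ?t" by (intro mult_strict_mono) (use st in auto)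
  then show "\<bar>\<rho>\<bar> < 1" using st by (simp add: \<rho> abs_mult)
  have "(\<integral>\<^sup>+\<eta>. ennreal (std_normal_cdf (d + a \<bullet> \<eta>)) \<partial>centred_normal S)
      = mass * (\<integral>\<^sup>+x. \<integral>\<^sup>+y. ennreal (std_normal_cdf (d + \<alpha> * x)) \<partial>N01 \<partial>N01)"
    using F[of "\<lambda>(u, v). ennreal (std_normal_cdf (d + u))"] by simp
  also have "\<dots> = mass * (\<integral>\<^sup>+x. ennreal (std_normal_cdf ((d + \<alpha> * x) / 1)) \<partial>N01)"
    using prob_space.emeasure_space_1[OF prob_space_std_normal] by simp
  also have "\<dots> = mass * ennreal (std_normal_cdf (d / ?s))"
    by (subst std_normal_cdf_mixture) auto
  finally show "(\<integral>\<^sup>+\<eta>. ennreal (std_normal_cdf (d + a \<bullet> \<eta>)) \<partial>centred_normal S)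
      = mass * ennreal (std_normal_cdf (d / sqrt (1 + a \<bullet> (S *v a))))" by (simp add: cov)
  have "(\<integral>\<^sup>+\<eta>. ennreal (std_normal_cdf (d + a \<bullet> \<eta>)) * ennreal (std_normal_cdf (e + b \<bullet> \<eta>)) \<partial>centred_normal S)
      = mass * (\<integral>\<^sup>+x. \<integral>\<^sup>+y. ennreal (std_normal_cdf (d + \<alpha> * x)) * ennreal (std_normal_cdf (e + \<beta> * x + \<gamma> * y)) \<partial>N01 \<partial>N01)"
    using F[of "\<lambda>(u, v). ennreal (std_normal_cdf (d + u)) * ennreal (std_normal_cdf (e + v))"]
    by (simp add: add.assoc)
  also have "\<dots> = mass * orthant_prob (d / ?s) (e / ?t) \<rho>"
    unfolding orthant_prob_standardize \<rho> ..
  finally show "(\<integral>\<^sup>+\<eta>. ennreal (std_normal_cdf (d + a \<bullet> \<eta>)) * ennreal (std_normal_cdf (e + b \<bullet> \<eta>)) \<partial>centred_normal S)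
      = mass * orthant_prob (d / sqrt (1 + a \<bullet> (S *v a))) (e / sqrt (1 + b \<bullet> (S *v b))) \<rho>"
    by (simp add: cov add.assoc)
qed

lemma ennreal_cancel_pos:
  fixes m x y :: ennreal
  assumes "0 < m" "m < \<infinity>" "m * x = m * y"
  shows "x = y"
  using assms by (auto simp: ennreal_mult_cancel_left)

lemma inj_std_normal_cdf: "ennreal (std_normal_cdf x) = ennreal (std_normal_cdf y) \<Longrightarrow> x = y"
  using std_normal_cdf_strict_mono std_normal_cdf_range
  by (auto simp: strict_mono_eq)

lemma orthant_prob_inj:
  assumes "orthant_prob u v r = orthant_prob u v r'" "\<bar>r\<bar> < 1" "\<bar>r'\<bar> < 1"
  shows "r = r'"
  using orthant_prob_neq[of r r' u v] orthant_prob_neq[of r' r u v] assms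
  by (cases r r' rule: linorder_cases) auto

lemma standardized_intercept_determined:
  fixes S S' :: "real^'n^'n" and a a' :: "real^'n"
  assumes S: "sym_pos_def S" "sym_pos_def S'" and k: "(k1 :: 'n) \<noteq> k2"
    and mass: "emeasure (centred_normal S) UNIV = emeasure (centred_normal S') UNIV"
    and one: "(\<integral>\<^sup>+\<eta>. ennreal (std_normal_cdf (d + a \<bullet> \<eta>)) \<partial>centred_normal S)
      = (\<integral>\<^sup>+\<eta>. ennreal (std_normal_cdf (d' + a' \<bullet> \<eta>)) \<partial>centred_normal S')"
  shows "d / sqrt (1 + a \<bullet> (S *v a)) = d' / sqrt (1 + a' \<bullet> (S' *v a'))"
proof -
  note P = centred_normal_probit_probs[OF S(1) k] and P' = centred_normal_probit_probs[OF S(2) k]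
  show ?thesis
    using ennreal_cancel_pos[OF P(1,2) one[unfolded P(4) P'(4) mass[symmetric]]]
    by (rule inj_std_normal_cdf)
qed

lemma correlation_determined:
  fixes S S' :: "real^'n^'n" and a b a' b' :: "real^'n"
  assumes S: "sym_pos_def S" "sym_pos_def S'" and k: "(k1 :: 'n) \<noteq> k2"
    and mass: "emeasure (centred_normal S) UNIV = emeasure (centred_normal S') UNIV"
    and one: "(\<integral>\<^sup>+\<eta>. ennreal (std_normal_cdf (d + a \<bullet> \<eta>)) \<partial>centred_normal S)
      = (\<integral>\<^sup>+\<eta>. ennreal (std_normal_cdf (d' + a' \<bullet> \<eta>)) \<partial>centred_normal S')"
      "(\<integral>\<^sup>+\<eta>. ennreal (std_normal_cdf (e + b \<bullet> \<eta>)) \<partial>centred_normal S)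
      = (\<integral>\<^sup>+\<eta>. ennreal (std_normal_cdf (e' + b' \<bullet> \<eta>)) \<partial>centred_normal S')"
    and two: "(\<integral>\<^sup>+\<eta>. ennreal (std_normal_cdf (d + a \<bullet> \<eta>)) * ennreal (std_normal_cdf (e + b \<bullet> \<eta>)) \<partial>centred_normal S)
      = (\<integral>\<^sup>+\<eta>. ennreal (std_normal_cdf (d' + a' \<bullet> \<eta>)) * ennreal (std_normal_cdf (e' + b' \<bullet> \<eta>)) \<partial>centred_normal S')"
  shows "a \<bullet> (S *v b) / (sqrt (1 + a \<bullet> (S *v a)) * sqrt (1 + b \<bullet> (S *v b)))
    = a' \<bullet> (S' *v b') / (sqrt (1 + a' \<bullet> (S' *v a')) * sqrt (1 + b' \<bullet> (S' *v b')))"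
proof -
  note P = centred_normal_probit_probs[OF S(1) k] and P' = centred_normal_probit_probs[OF S(2) k]
  note intercepts = standardized_intercept_determined[OF S k mass one(1)]
    standardized_intercept_determined[OF S k mass one(2)]
  show ?thesis
    using ennreal_cancel_pos[OF P(1,2) two[unfolded P(5) P'(5) mass[symmetric]]] P(3) P'(3)
    unfolding intercepts by (rule orthant_prob_inj)
qed

section \<open>Vector systems with partially equal Gram matrices\<close>

text \<open>
  Two systems of vectors, with their own inner products \<open>S\<close> and \<open>S'\<close>, that have the same Gram matrix
  entries at rows \<open>U\<close> and columns \<open>V\<close>.
\<close>

definition gram_agree ::
  "real^'n^'n \<Rightarrow> ('j \<Rightarrow> real^'n) \<Rightarrow> real^'n^'n \<Rightarrow> ('j \<Rightarrow> real^'n) \<Rightarrow> 'j set \<Rightarrow> 'j set \<Rightarrow> bool" where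
  "gram_agree S x S' y U V \<longleftrightarrow> (\<forall>u\<in>U. \<forall>v\<in>V. x u \<bullet> (S *v x v) = y u \<bullet> (S' *v y v))"

lemma gram_agree_commute:
  assumes "sym_pos_def S" "sym_pos_def S'" "gram_agree S x S' y U V"
  shows "gram_agree S x S' y V U"
  unfolding gram_agree_def
proof (intro ballI)
  fix v u assume "v \<in> V" "u \<in> U"
  then have "x u \<bullet> (S *v x v) = y u \<bullet> (S' *v y v)"
    using assms(3) by (simp add: gram_agree_def)
  then show "x v \<bullet> (S *v x u) = y v \<bullet> (S' *v y u)"
    by (simp only: sym_pos_def_inner_commute[OF assms(1), of "x v"]
        sym_pos_def_inner_commute[OF assms(2), of "y v"])
qed

text \<open>
  The inner products of \<open>z\<close> with the vectors of \<open>U\<close>, which serve as coordinates if these vectors span.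
  They live in \<open>real ^ 'j\<close> for both systems, so vectors of the two systems can be compared.
\<close>

definition cross_gram :: "real^'n^'n \<Rightarrow> ('j::finite \<Rightarrow> real^'n) \<Rightarrow> 'j set \<Rightarrow> real^'n \<Rightarrow> real^'j" where
  "cross_gram S x U z = (\<chi> u. if u \<in> U then x u \<bullet> (S *v z) else 0)"

lemma linear_cross_gram: "linear (cross_gram S x U)"
  by (rule linearI)
     (auto simp: cross_gram_def vec_eq_iff matrix_vector_right_distrib inner_add_right
        matrix_vector_mult_scaleR)

lemma inj_cross_gram:
  assumes "sym_pos_def S" "span (x ` U) = UNIV"
  shows "inj (cross_gram S x U)"
proof (rule injI)
  fix y z assume eq: "cross_gram S x U y = cross_gram S x U z"
  have "S *v y = S *v z"
  proof (rule eq_if_inner_spanning[OF assms(2)])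
    fix u assume "u \<in> U"
    then show "x u \<bullet> (S *v y) = x u \<bullet> (S *v z)"
      using arg_cong[OF eq, of "\<lambda>w. w $ u"] by (simp add: cross_gram_def)
  qed
  then show "y = z" by (rule sym_pos_def_inj[OF assms(1)])
qed

lemma cross_gram_eq:
  assumes "gram_agree S x S' y U V" "v \<in> V"
  shows "cross_gram S x U (x v) = cross_gram S' y U (y v)"
  using assms by (auto simp: gram_agree_def cross_gram_def vec_eq_iff)

text \<open>
  Where the Gram matrices agree, the coordinate maps send \<open>x ` V\<close> and \<open>y ` V\<close> to the same set. For
  \<open>x\<close> its span has full dimension, and a linear map cannot raise the dimension of \<open>span (y ` V)\<close>.
\<close>

lemma gram_agree_spanning:
  fixes x y :: "'j::finite \<Rightarrow> real^'n"
  assumes "sym_pos_def S" and U: "span (x ` U) = UNIV" and V: "span (x ` V) = UNIV"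
    and agree: "gram_agree S x S' y U V"
  shows "span (y ` V) = UNIV"
proof -
  let ?T = "cross_gram S x U" and ?T' = "cross_gram S' y U"
  have "range ?T = ?T ` span (x ` V)" using V by simp
  also have "\<dots> = span (?T ` x ` V)" by (rule linear_span_image[OF linear_cross_gram, symmetric])
  also have "?T ` x ` V = ?T' ` y ` V"
    unfolding image_image using cross_gram_eq[OF agree] by (rule image_cong[OF refl])
  also have "span (?T' ` y ` V) = ?T' ` span (y ` V)" by (rule linear_span_image[OF linear_cross_gram])
  finally have *: "range ?T = ?T' ` span (y ` V)" .
  have "dim (UNIV :: (real^'n) set) = dim (range ?T)"
    using dim_image_eq[OF linear_cross_gram, of S x U UNIV] inj_cross_gram[OF assms(1) U]
    by (simp add: inj_on_subset)
  also have "\<dots> \<le> dim (span (y ` V))"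
    unfolding * by (rule dim_image_le[OF linear_cross_gram])
  finally have "dim (span (y ` V)) = DIM(real^'n)"
    using dim_subset_UNIV[of "span (y ` V)"] by (intro antisym) (simp_all only: dim_UNIV)
  then show ?thesis by (simp only: dim_eq_full span_span)
qed

text \<open>
  The coordinates of \<open>y v\<close> in the second system are those of \<open>x v\<close> in the first one, and the second
  coordinate map has a linear left inverse.
\<close>

lemma gram_agree_linear:
  fixes x y :: "'j::finite \<Rightarrow> real^'n"
  assumes "sym_pos_def S'" and U': "span (y ` U) = UNIV" and agree: "gram_agree S x S' y U V"
  obtains Q where "linear Q" "\<And>v. v \<in> V \<Longrightarrow> y v = Q (x v)"
proof -
  let ?T = "cross_gram S x U" and ?T' = "cross_gram S' y U"
  obtain R where R: "linear R" "R \<circ> ?T' = id"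
    using linear_injective_left_inverse[OF linear_cross_gram inj_cross_gram[OF assms(1) U']] by blast
  show thesis
  proof (rule that[of "R \<circ> ?T"])
    show "linear (R \<circ> ?T)" by (rule linear_compose[OF linear_cross_gram R(1)])
    show "y v = (R \<circ> ?T) (x v)" if "v \<in> V" for v
      using cross_gram_eq[OF agree that] R(2) by (simp add: fun_eq_iff)
  qed
qed

text \<open>
  On \<open>V\<close> the second system is the image of the first one under \<open>Q\<close>, so its inner products are those
  of the form \<open>Q\<^sup>T S' Q\<close>. This form and \<open>S\<close> give \<open>x z\<close> the same product with the spanning
  vectors of \<open>W\<close>, hence with every vector.
\<close>

lemma gram_agree_extend:
  fixes x y :: "'j::finite \<Rightarrow> real^'n"
  assumes Q: "linear Q" "\<And>v. v \<in> V \<Longrightarrow> y v = Q (x v)"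
    and W: "W \<subseteq> V" "span (x ` W) = UNIV" and Z: "Z \<subseteq> V" and agree: "gram_agree S x S' y W Z"
  shows "gram_agree S x S' y V Z"
  unfolding gram_agree_def
proof (intro ballI)
  fix v z assume vz: "v \<in> V" "z \<in> Z"
  have "S *v x z = adjoint Q (S' *v Q (x z))"
  proof (rule eq_if_inner_spanning[OF W(2)])
    fix w assume w: "w \<in> W"
    have "x w \<bullet> (S *v x z) = y w \<bullet> (S' *v y z)" using agree w vz by (simp add: gram_agree_def)
    also have "\<dots> = Q (x w) \<bullet> (S' *v Q (x z))" using Q(2) w vz W Z by (simp add: subset_iff)
    finally show "x w \<bullet> (S *v x z) = x w \<bullet> adjoint Q (S' *v Q (x z))"
      by (simp add: adjoint_works[OF Q(1)])
  qed
  then show "x v \<bullet> (S *v x z) = y v \<bullet> (S' *v y z)"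
    using Q(2) vz Z by (simp add: adjoint_works[OF Q(1)] subset_iff)
qed

text \<open>
  A generalization of the Anderson-Rubin argument for the communalities of a factor model. Comparison
  through \<open>B1\<close> relates the two systems on \<open>B2\<close> by a linear map; for \<open>j\<close> in \<open>B2a\<close> the other items of \<open>B2\<close>
  still span, which yields the diagonal entry at \<open>j\<close>. Then every entry with row in \<open>B2a\<close> is known,
  and since \<open>B2a\<close> spans, a second comparison through \<open>B2a\<close> itself yields all entries.
\<close>

lemma gram_diagonal_determined:
  fixes x y :: "'j::finite \<Rightarrow> real^'n"
  assumes S: "sym_pos_def S" "sym_pos_def S'"
    and off: "\<And>i j. i \<noteq> j \<Longrightarrow> x i \<bullet> (S *v x j) = y i \<bullet> (S' *v y j)"
    and B: "B1 \<inter> B2 = {}" "B2a \<subseteq> B2"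
    and sp: "span (x ` B1) = UNIV" "span (x ` B2a) = UNIV"
      "\<And>j. j \<in> B2a \<Longrightarrow> span (x ` (B2 - {j})) = UNIV"
  shows "gram_agree S x S' y UNIV UNIV"
proof -
  have off': "gram_agree S x S' y U V" if "U \<inter> V = {}" for U V
    using off that by (force simp: gram_agree_def)
  have "span (x ` B2) = UNIV"
    using sp(2) span_mono[OF image_mono[OF B(2)], of x] by auto
  then have spy: "span (y ` B1) = UNIV"
    by (rule gram_agree_spanning[OF S(1) _ sp(1)]) (use B off' in blast)
  obtain Q where Q: "linear Q" "\<And>v. v \<in> B2 \<Longrightarrow> y v = Q (x v)"
    using gram_agree_linear[OF S(2) spy off'[OF B(1)]] by blast
  have "x j \<bullet> (S *v x j) = y j \<bullet> (S' *v y j)" if "j \<in> B2a" for j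
  proof -
    have "gram_agree S x S' y B2 {j}"
      by (rule gram_agree_extend[OF Q _ sp(3)[OF that]]) (use off' B that in auto)
    then show ?thesis using that B by (auto simp: gram_agree_def)
  qed
  then have 2: "gram_agree S x S' y B2a UNIV"
    unfolding gram_agree_def using off by (intro ballI) (rename_tac u v, case_tac "u = v", auto)
  then have "gram_agree S x S' y B2a B2a" by (simp add: gram_agree_def)
  then have "span (y ` B2a) = UNIV"
    by (rule gram_agree_spanning[OF S(1) sp(2) sp(2)])
  then obtain Q where "linear Q" "\<And>v. v \<in> UNIV \<Longrightarrow> y v = Q (x v)"
    using gram_agree_linear[OF S(2) _ 2] by blast
  then show ?thesis
    by (rule gram_agree_extend[OF _ _ _ sp(2) _ 2]) auto
qed

section \<open>Bifactor structure\<close>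

text \<open>
  The products determine a column up to its sign, which is fixed by the first nonzero entry.
\<close>

lemma column_eq_if_products_eq:
  fixes x y :: "'j::{finite,linorder} \<Rightarrow> real"
  assumes prod: "\<And>i j. x i * x j = y i * y j"
    and x: "\<And>j. x j \<noteq> 0 \<Longrightarrow> (\<forall>i<j. x i = 0) \<Longrightarrow> 0 < x j"
    and y: "\<And>j. y j \<noteq> 0 \<Longrightarrow> (\<forall>i<j. y i = 0) \<Longrightarrow> 0 < y j"
  shows "x = y"
proof (cases "\<forall>j. x j = 0")
  case True
  then have "y j = 0" for j using prod[of j j] by simp
  then show ?thesis using True by auto
next
  case False
  have zero: "x j = 0 \<longleftrightarrow> y j = 0" for j using prod[of j j] by auto
  obtain k where k: "x k \<noteq> 0" and first: "\<forall>i<k. x i = 0"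
  proof (rule that[of "Min {j. x j \<noteq> 0}"])
    show "x (Min {j. x j \<noteq> 0}) \<noteq> 0" using Min_in[of "{j. x j \<noteq> 0}"] False by auto
    show "\<forall>i<Min {j. x j \<noteq> 0}. x i = 0"
    proof (intro allI impI)
      fix i assume "i < Min {j. x j \<noteq> 0}"
      moreover have "Min {j. x j \<noteq> 0} \<le> i" if "x i \<noteq> 0" using that by (intro Min_le) auto
      ultimately show "x i = 0" by (meson leD)
    qed
  qed
  have "0 < x k" using x[OF k first] .
  have "y k \<noteq> 0" "\<forall>i<k. y i = 0" using k first zero by auto
  then have "0 < y k" by (rule y)
  have "(x k)\<^sup>2 = (y k)\<^sup>2" using prod[of k k] by (simp add: power2_eq_square)
  then have "x k = y k" using \<open>0 < x k\<close> \<open>0 < y k\<close> by (simp add: power2_eq_iff_nonneg)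
  have "x j = y j" for j
    using prod[of j k] \<open>0 < y k\<close> unfolding \<open>x k = y k\<close> by simp
  then show ?thesis by auto
qed

text \<open>
  Comparison through group \<open>g\<close> gives a linear map that is valid outside \<open>g\<close>, and comparison
  through \<open>h\<close> one that is valid outside \<open>h\<close>. They agree on the spanning group \<open>k\<close>, so they
  are one map, valid everywhere.
\<close>

lemma gram_agree_three_groups:
  fixes x y :: "'j::finite \<Rightarrow> real^'n" and t :: "'j \<Rightarrow> 'g"
  assumes S: "sym_pos_def S" "sym_pos_def S'"
    and off: "\<And>i j. t i \<noteq> t j \<Longrightarrow> x i \<bullet> (S *v x j) = y i \<bullet> (S' *v y j)"
    and ne: "g \<noteq> h" "g \<noteq> k" "h \<noteq> k"
    and sp: "\<And>f. f \<in> {g, h, k} \<Longrightarrow> span (x ` (t -` {f})) = UNIV"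
  shows "gram_agree S x S' y UNIV UNIV"
proof -
  have off': "gram_agree S x S' y (t -` F) (t -` H)" if "F \<inter> H = {}" for F H
    unfolding gram_agree_def using that by (intro ballI off) auto
  have spy: "span (y ` (t -` {f})) = UNIV" if "f \<in> {g, h}" for f
  proof (rule gram_agree_spanning[OF S(1)])
    show "gram_agree S x S' y (t -` {k}) (t -` {f})" by (rule off') (use ne that in auto)
  qed (use sp that in auto)
  have ex_Q: "\<exists>Q. linear Q \<and> (\<forall>v. t v \<noteq> f \<longrightarrow> y v = Q (x v))" if f: "f \<in> {g, h}" for f
  proof -
    have "gram_agree S x S' y (t -` {f}) (t -` (- {f}))" by (rule off') auto
    then obtain Q where "linear Q" "\<And>v. v \<in> t -` (- {f}) \<Longrightarrow> y v = Q (x v)"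
      using gram_agree_linear[OF S(2) spy[OF f]] by blast
    then show ?thesis by auto
  qed
  obtain Qg where Qg: "linear Qg" "\<And>v. t v \<noteq> g \<Longrightarrow> y v = Qg (x v)" using ex_Q[of g] by auto
  obtain Qh where Qh: "linear Qh" "\<And>v. t v \<noteq> h \<Longrightarrow> y v = Qh (x v)" using ex_Q[of h] by auto
  have "Qg z = Qh z" for z
  proof (rule linear_eq_on[OF Qg(1) Qh(1)])
    show "z \<in> span (x ` (t -` {k}))" using sp by simp
    fix w assume "w \<in> x ` (t -` {k})"
    then obtain v where "w = x v" "t v = k" by auto
    then show "Qg w = Qh w" using Qg(2)[of v] Qh(2)[of v] ne by simp
  qed
  then have Q: "y v = Qg (x v)" for v
    using Qg(2)[of v] Qh(2)[of v] ne by (cases "t v = g") auto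
  have g_all: "gram_agree S x S' y UNIV (t -` {f})" if "f \<in> {g, h}" for f
  proof -
    have "gram_agree S x S' y (t -` {k}) (t -` {f})" by (rule off') (use ne that in auto)
    from gram_agree_extend[OF Qg(1) Q _ _ _ this] show ?thesis using sp by simp
  qed
  then have "gram_agree S x S' y UNIV (t -` {g})" by simp
  note gram_agree_commute[OF S this]
  from gram_agree_extend[OF Qg(1) Q _ _ _ this] show ?thesis using sp by simp
qed

text \<open>
  The main part agrees between \<open>G1\<close> and \<open>G2\<close>, so on \<open>G1\<close> the two systems are related by a linear map.
  A combination of rows of \<open>G1\<close> that annihilates the main loadings therefore annihilates them in both
  models, and applied to the covariance it isolates the testlet loadings: it shows that they agree
  up to a factor of square \<open>1\<close> on each testlet of \<open>G1\<close>. So the main part also agrees within \<open>G1\<close>, and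
  comparison through \<open>G1\<close> reaches all items.
\<close>

lemma gram_agree_two_halves:
  fixes m m' :: "'j::finite \<Rightarrow> real^'n" and t :: "'j \<Rightarrow> 'g" and b b' :: "'j \<Rightarrow> real"
  assumes S: "sym_pos_def S" "sym_pos_def S'"
    and eq: "\<And>i j. m i \<bullet> (S *v m j) + (if t i = t j then b i * b j else 0)
        = m' i \<bullet> (S' *v m' j) + (if t i = t j then b' i * b' j else 0)"
    and G: "G1 \<union> G2 = UNIV" "G1 \<inter> G2 = {}"
    and sp: "span (m ` (t -` G1)) = UNIV" "span (m ` (t -` G2)) = UNIV"
    and annihilator: "\<And>g. g \<in> G1 \<Longrightarrow> \<exists>x. (\<Sum>i\<in>t -` G1. x i *\<^sub>R m i) = 0 \<and> (\<Sum>i\<in>t -` {g}. x i * b i) = 1"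
  shows "gram_agree S m S' m' UNIV UNIV"
proof -
  let ?U = "t -` G1" and ?V = "t -` G2"
  have UV: "gram_agree S m S' m' ?U ?V"
    unfolding gram_agree_def
  proof (intro ballI)
    fix u v assume "u \<in> ?U" "v \<in> ?V"
    then have "t u \<noteq> t v" using G by auto
    then show "m u \<bullet> (S *v m v) = m' u \<bullet> (S' *v m' v)" using eq[of u v] by simp
  qed
  note VU = gram_agree_commute[OF S UV]
  have spV: "span (m' ` ?V) = UNIV" by (rule gram_agree_spanning[OF S(1) sp UV])
  obtain Q where Q: "linear Q" "\<And>v. v \<in> ?U \<Longrightarrow> m' v = Q (m v)"
    using gram_agree_linear[OF S(2) spV VU] by blast
  have bb: "b' i * b' j = b i * b j" if ij: "t i = t j" "t j \<in> G1" for i j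
  proof -
    let ?g = "t j"
    obtain x where x: "(\<Sum>i\<in>?U. x i *\<^sub>R m i) = 0" "(\<Sum>i\<in>t -` {?g}. x i * b i) = 1"
      using annihilator[OF ij(2)] by blast
    have x': "(\<Sum>i\<in>?U. x i *\<^sub>R m' i) = 0"
    proof -
      have "(\<Sum>i\<in>?U. x i *\<^sub>R m' i) = (\<Sum>i\<in>?U. Q (x i *\<^sub>R m i))"
        by (intro sum.cong refl) (simp add: Q(2) linear_cmul[OF Q(1)])
      also have "\<dots> = Q (\<Sum>i\<in>?U. x i *\<^sub>R m i)" by (rule linear_sum[OF Q(1), symmetric])
      finally show ?thesis using x(1) by (simp add: linear_0[OF Q(1)])
    qed
    define c where "c = (\<Sum>i\<in>t -` {?g}. x i * b' i)"
    have b: "b k = c * b' k" if k: "t k = ?g" for k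
    proof -
      have contract: "(\<Sum>i\<in>?U. x i * (n i \<bullet> (T *v n k) + (if t i = t k then a i * a k else 0)))
          = (\<Sum>i\<in>?U. x i *\<^sub>R n i) \<bullet> (T *v n k) + (\<Sum>i\<in>t -` {?g}. x i * a i) * a k"
        for n :: "'j \<Rightarrow> real^'n" and T :: "real^'n^'n" and a :: "'j \<Rightarrow> real"
      proof -
        have "(\<Sum>i\<in>?U. x i * (if t i = t k then a i * a k else 0)) = (\<Sum>i\<in>t -` {?g}. x i * a i * a k)"
          by (intro sum.mono_neutral_cong_right) (use k ij in auto)
        then show ?thesis
          by (simp add: distrib_left sum.distrib inner_sum_left sum_distrib_right)
      qed
      have "(\<Sum>i\<in>?U. x i * (m i \<bullet> (S *v m k) + (if t i = t k then b i * b k else 0)))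
          = (\<Sum>i\<in>?U. x i * (m' i \<bullet> (S' *v m' k) + (if t i = t k then b' i * b' k else 0)))"
        by (simp only: eq)
      then show ?thesis unfolding contract x x' c_def by simp
    qed
    have "1 = (\<Sum>i\<in>t -` {?g}. x i * (c * b' i))"
      unfolding x(2)[symmetric] by (intro sum.cong) (auto simp: b)
    also have "\<dots> = c * c" by (simp add: c_def sum_distrib_left mult_ac)
    finally have "c * c = 1" by simp
    have "b i * b j = (c * c) * (b' i * b' j)"
      unfolding b[OF ij(1)] b[OF refl] by (simp only: mult_ac)
    then show ?thesis by (simp only: \<open>c * c = 1\<close> mult_1)
  qed
  have U: "gram_agree S m S' m' ?U UNIV"
    unfolding gram_agree_def
  proof (intro ballI)
    fix u v assume u: "u \<in> ?U"
    show "m u \<bullet> (S *v m v) = m' u \<bullet> (S' *v m' v)"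
      using eq[of u v] bb[of u v] u by (cases "t u = t v") auto
  qed
  have "span (m' ` ?U) = UNIV"
    by (rule gram_agree_spanning[OF S(1) sp(2) sp(1) VU])
  then obtain R where "linear R" "\<And>v. v \<in> UNIV \<Longrightarrow> m' v = R (m v)"
    using gram_agree_linear[OF S(2) _ U] by blast
  then show ?thesis by (rule gram_agree_extend[OF _ _ _ sp(1) _ U]) auto
qed

text \<open>
  Equal Gram matrices give a linear map \<open>Q\<close> between the main loadings. On the identity rows both
  systems have multiples of the unit vectors, so \<open>Q\<close> is diagonal; unit diagonals of \<open>S\<close> and \<open>S'\<close> make
  its entries \<open>\<plusminus>1\<close>, and the sign convention makes it the identity.
\<close>

lemma main_part_determined:
  fixes m m' :: "'j::{finite,linorder} \<Rightarrow> real^'n"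
  assumes S: "sym_pos_def S" "sym_pos_def S'"
    and diag: "\<And>l. S $ l $ l = 1" "\<And>l. S' $ l $ l = 1"
    and agree: "gram_agree S m S' m' UNIV UNIV" and sp: "span (range m) = UNIV"
    and pattern: "\<And>j l. m j $ l = 0 \<longleftrightarrow> m' j $ l = 0"
    and identity: "\<And>l. \<exists>j. m j $ l \<noteq> 0 \<and> (\<forall>l'. l' \<noteq> l \<longrightarrow> m j $ l' = 0)"
    and sign: "\<And>l j. m j $ l \<noteq> 0 \<Longrightarrow> (\<forall>i<j. m i $ l = 0) \<Longrightarrow> 0 < m j $ l"
      "\<And>l j. m' j $ l \<noteq> 0 \<Longrightarrow> (\<forall>i<j. m' i $ l = 0) \<Longrightarrow> 0 < m' j $ l"
  shows "m = m' \<and> S = S'"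
proof -
  obtain q where q: "\<And>l. m (q l) $ l \<noteq> 0" "\<And>l l'. l' \<noteq> l \<Longrightarrow> m (q l) $ l' = 0"
    using identity by metis
  define c where "c l = m (q l) $ l" for l
  define c' where "c' l = m' (q l) $ l" for l
  have c: "c l \<noteq> 0" for l using q(1) by (simp add: c_def)
  have mq: "m (q l) = c l *\<^sub>R axis l 1" for l
    using q(2) by (auto simp: vec_eq_iff axis_def c_def)
  have mq': "m' (q l) = c' l *\<^sub>R axis l 1" for l
    using q(2) pattern by (auto simp: vec_eq_iff axis_def c'_def)
  have gram_q: "c l * c k * S $ l $ k = c' l * c' k * S' $ l $ k" for l k
  proof -
    have scaled: "a *\<^sub>R axis l 1 \<bullet> (T *v (e *\<^sub>R axis k 1)) = a * e * T $ l $ k"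
      for a e and T :: "real^'n^'n"
      by (simp add: matrix_vector_mult_scaleR inner_axis' matrix_vector_mult_basis column_def)
    have "m (q l) \<bullet> (S *v m (q k)) = m' (q l) \<bullet> (S' *v m' (q k))"
      using agree by (simp add: gram_agree_def)
    then show ?thesis by (simp only: mq mq' scaled)
  qed
  define r where "r l = c' l / c l" for l
  have c': "c' l \<noteq> 0" for l using q(1) pattern by (simp add: c'_def)
  have r2: "r l * r l = 1" for l
  proof -
    have "c l * c l = c' l * c' l" using gram_q[of l l] by (simp add: diag)
    moreover have "r l * r l = (c' l * c' l) / (c l * c l)" by (simp add: r_def)
    ultimately show ?thesis using c'[of l] by simp
  qed
  have "span (m' ` UNIV) = UNIV" by (rule gram_agree_spanning[OF S(1) sp sp agree])
  then obtain Q where "linear Q" "\<And>v. v \<in> UNIV \<Longrightarrow> m' v = Q (m v)"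
    using gram_agree_linear[OF S(2) _ agree] by blast
  then have Q: "linear Q" "\<And>v. m' v = Q (m v)" by auto
  have Q_axis: "Q (axis l 1) = r l *\<^sub>R axis l 1" for l
  proof -
    have "c l *\<^sub>R Q (axis l 1) = Q (m (q l))"
      by (simp only: mq linear_cmul[OF Q(1)])
    also have "\<dots> = c' l *\<^sub>R axis l 1" by (simp only: Q(2)[symmetric] mq')
    finally have "(1 / c l) *\<^sub>R (c l *\<^sub>R Q (axis l 1)) = (1 / c l) *\<^sub>R c' l *\<^sub>R axis l 1"
      by simp
    then show ?thesis using c[of l] by (simp add: r_def)
  qed
  have m': "m' j $ l = r l * m j $ l" for j l
  proof -
    have "m' j = Q (\<Sum>k\<in>UNIV. m j $ k *\<^sub>R axis k 1)"
      using basis_expansion[of "m j"] by (simp add: Q(2) scalar_mult_eq_scaleR)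
    also have "\<dots> = (\<Sum>k\<in>UNIV. m j $ k *\<^sub>R r k *\<^sub>R axis k 1)"
      by (simp add: linear_sum[OF Q(1)] linear_cmul[OF Q(1)] Q_axis)
    finally show ?thesis by (simp add: axis_def if_distrib[of "\<lambda>x. _ * x"] cong: if_cong)
  qed
  have "(\<lambda>j. m j $ l) = (\<lambda>j. m' j $ l)" for l
  proof (rule column_eq_if_products_eq)
    show "m i $ l * m j $ l = m' i $ l * m' j $ l" for i j
    proof -
      have "m' i $ l * m' j $ l = (r l * r l) * (m i $ l * m j $ l)"
        unfolding m' by (simp only: mult_ac)
      then show ?thesis by (simp only: r2 mult_1)
    qed
  qed (use sign in auto)
  then have eq: "m = m'" by (simp add: fun_eq_iff vec_eq_iff)
  have "c' l = c l" for l by (simp add: c_def c'_def eq)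
  then have "S $ l $ k = S' $ l $ k" for l k
    using gram_q[of l k] c[of l] c[of k] by simp
  then show ?thesis using eq by (simp add: vec_eq_iff)
qed

section \<open>Covariances in the two-tier model\<close>

text \<open>
  The probability that all items of \<open>U\<close> are answered correctly. It is a sum of point masses, so that
  only these are needed from the response distribution; for the empty set it is the total mass.
\<close>

definition success_prob ::
  "('j::finite \<Rightarrow> 'g::finite) \<Rightarrow> ('j, 'l::finite, 'g) two_tier_params \<Rightarrow> 'j set \<Rightarrow> ennreal" where
  "success_prob t p U = (\<Sum>y | \<forall>j\<in>U. y j. emeasure (response_distribution t p) {y})"

lemma success_prob_eq:
  fixes A :: "real ^ ('l::finite + 'g::finite) ^ 'j::finite"
  shows "success_prob t (A, d, S) U
    = (\<integral>\<^sup>+\<eta>. (\<Prod>j\<in>U. ennreal (correct_prob t A d \<eta> j)) \<partial>centred_normal (factor_cov S))"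
proof -
  let ?N = "centred_normal (factor_cov S) :: (real ^ ('l + 'g)) measure"
  let ?p = "correct_prob t A d"
  let ?X = "{y :: 'j \<Rightarrow> bool. \<forall>j\<in>U. y j}"
  let ?f = "\<lambda>y \<eta>. ennreal (\<Prod>j\<in>UNIV. if y j then ?p \<eta> j else 1 - ?p \<eta> j)"
  have p01: "0 \<le> ?p \<eta> j" "?p \<eta> j \<le> 1" for \<eta> j
    by (auto simp: correct_prob_def std_normal_cdf_range)
  have sum: "(\<Sum>y\<in>?X. ?f y \<eta>) = (\<Prod>j\<in>U. ennreal (?p \<eta> j))" for \<eta>
  proof -
    let ?M = "cond_response_pmf t A d \<eta>"
    have pmf: "pmf ?M y = (\<Prod>j\<in>UNIV. if y j then ?p \<eta> j else 1 - ?p \<eta> j)" for y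
      unfolding cond_response_pmf_def by (subst pmf_Pi') (auto simp: p01 intro!: prod.cong)
    have "emeasure ?M ?X = (\<Sum>y\<in>?X. ennreal (pmf ?M y))"
      by (subst emeasure_measure_pmf_finite) (auto simp: sum_ennreal)
    then have "(\<Sum>y\<in>?X. ?f y \<eta>) = emeasure ?M ?X" by (simp only: pmf)
    also have "emeasure ?M ?X = ennreal (\<Prod>j\<in>UNIV. if j \<in> U then ?p \<eta> j else 1)"
    proof -
      have X: "?X = Pi UNIV (\<lambda>j. if j \<in> U then {True} else UNIV)"
        by (auto simp: Pi_def split: if_splits)
      show ?thesis
        unfolding cond_response_pmf_def measure_pmf.emeasure_eq_measure X
        by (subst measure_Pi_pmf_Pi)
           (auto intro!: arg_cong[where f = ennreal] prod.cong simp: p01 measure_pmf_single)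
    qed
    also have "\<dots> = (\<Prod>j\<in>U. ennreal (?p \<eta> j))"
      using p01 by (simp add: prod.If_cases prod_ennreal)
    finally show ?thesis .
  qed
  have meas: "?f y \<in> borel_measurable ?N" for y
  proof -
    have "(\<lambda>\<eta>. ?p \<eta> j) \<in> borel_measurable borel" for j
      unfolding correct_prob_def by (rule measurable_compose[OF _ std_normal_cdf_measurable]) simp
    then have "(\<lambda>\<eta>. if y j then ?p \<eta> j else 1 - ?p \<eta> j) \<in> borel_measurable borel" for j
      by (cases "y j") auto
    then have "?f y \<in> borel_measurable borel"
      by (intro measurable_compose[OF _ measurable_ennreal] borel_measurable_prod)
    then show ?thesis by (simp add: centred_normal_def)
  qed
  have "success_prob t (A, d, S) U = (\<Sum>y\<in>?X. \<integral>\<^sup>+\<eta>. ?f y \<eta> \<partial>?N)"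
    unfolding success_prob_def emeasure_response_distribution ..
  also have "\<dots> = (\<integral>\<^sup>+\<eta>. (\<Sum>y\<in>?X. ?f y \<eta>) \<partial>?N)"
    by (rule nn_integral_sum[symmetric]) (rule meas)
  finally show ?thesis unfolding sum .
qed

lemma factor_cov_inner:
  fixes x y :: "real ^ ('l::finite + 'g::finite)"
  shows "x \<bullet> (factor_cov S *v y)
    = (\<chi> l. x $ Inl l) \<bullet> (S *v (\<chi> l. y $ Inl l)) + (\<Sum>g\<in>UNIV. x $ Inr g * y $ Inr g)"
proof -
  have sum_split: "(\<Sum>k\<in>UNIV. f k) = (\<Sum>l\<in>UNIV. f (Inl l)) + (\<Sum>g\<in>UNIV. f (Inr g))"
    for f :: "'l + 'g \<Rightarrow> real"
    by (subst UNIV_sum, subst sum.union_disjoint) (auto simp: sum.reindex)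
  have "(factor_cov S *v y) $ Inl l = (S *v (\<chi> l. y $ Inl l)) $ l"
    and "(factor_cov S *v y) $ Inr g = y $ Inr g" for l g
    by (simp_all add: factor_cov_def matrix_vector_mult_def sum_split if_distrib[of "\<lambda>c. c * _"] cong: if_cong)
  then show ?thesis by (simp add: inner_vec_def sum_split)
qed

lemma sym_pos_def_factor_cov:
  fixes S :: "real ^ 'l::finite ^ 'l"
  assumes S: "sym_pos_def S"
  shows "sym_pos_def (factor_cov S :: real ^ ('l + 'g::finite) ^ ('l + 'g))"
  unfolding sym_pos_def_def
proof (intro conjI allI impI)
  have "S $ l $ l' = S $ l' $ l" for l l'
  proof -
    have "S $ l $ l' = transpose S $ l $ l'" using S by (simp add: sym_pos_def_def)
    then show ?thesis by (simp add: transpose_def)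
  qed
  then show "transpose (factor_cov S) = (factor_cov S :: real ^ ('l + 'g) ^ ('l + 'g))"
    by (auto simp: vec_eq_iff transpose_def factor_cov_def split: sum.splits)
next
  fix x :: "real ^ ('l + 'g)" assume "x \<noteq> 0"
  let ?u = "\<chi> l. x $ Inl l"
  have nonneg: "0 \<le> ?u \<bullet> (S *v ?u)" "0 \<le> (\<Sum>g\<in>UNIV. x $ Inr g * x $ Inr g)"
    using S by (cases "?u = 0"; simp add: sym_pos_def_def less_imp_le sum_nonneg)+
  obtain k where "x $ k \<noteq> 0" using \<open>x \<noteq> 0\<close> by (auto simp: vec_eq_iff)
  then consider l where "x $ Inl l \<noteq> 0" | g where "x $ Inr g \<noteq> 0" by (cases k) auto
  then show "0 < x \<bullet> (factor_cov S *v x)"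
  proof cases
    case 1
    then have "?u \<noteq> 0" by (auto simp: vec_eq_iff)
    then have "0 < ?u \<bullet> (S *v ?u)" using S by (simp add: sym_pos_def_def)
    then show ?thesis using nonneg(2) by (simp add: factor_cov_inner)
  next
    case 2
    then have "0 < (\<Sum>g\<in>UNIV. x $ Inr g * x $ Inr g)"
      by (intro sum_pos2[of _ g]) (auto simp: zero_less_mult_iff linorder_neq_iff)
    then show ?thesis using nonneg(1) by (simp add: factor_cov_inner)
  qed
qed

lemma correct_prob_inner:
  assumes "\<And>g. g \<noteq> t j \<Longrightarrow> A $ j $ Inr g = 0"
  shows "correct_prob t A d \<eta> j = std_normal_cdf (d $ j + A $ j \<bullet> \<eta>)"
proof -
  have "A $ j \<bullet> \<eta> = (\<Sum>l\<in>UNIV. A $ j $ Inl l * \<eta> $ Inl l) + (\<Sum>g\<in>UNIV. A $ j $ Inr g * \<eta> $ Inr g)"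
    unfolding inner_vec_def by (subst UNIV_sum, subst sum.union_disjoint) (auto simp: sum.reindex)
  also have "(\<Sum>g\<in>UNIV. A $ j $ Inr g * \<eta> $ Inr g) = A $ j $ Inr (t j) * \<eta> $ Inr (t j)"
    using assms by (subst sum.remove[of _ "t j"]) (auto intro!: sum.neutral)
  finally show ?thesis by (simp add: correct_prob_def add.assoc)
qed

text \<open>
  The first two stages. The off-diagonal correlations and standardized intercepts come from pairs of
  items, and \<open>gram_diagonal_determined\<close> is applied to the standardized rows \<open>a\<^sub>i / s\<^sub>i\<close>, whose squared
  norms \<open>1 - 1 / s\<^sub>i\<^sup>2\<close> reveal \<open>s\<^sub>i\<close>.
\<close>

lemma two_tier_covariances_determined:
  fixes t :: "'j::{finite,linorder} \<Rightarrow> 'g::finite"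
    and A A' :: "real ^ ('l::finite + 'g) ^ 'j::{finite,linorder}"
  assumes p: "(A, d, S) \<in> param_space t" "(A', d', S') \<in> param_space t" and C1: "cond_C1 A"
    and eq: "response_distribution t (A', d', S') = response_distribution t (A, d, S)"
  shows "A $ i \<bullet> (factor_cov S *v A $ j) = A' $ i \<bullet> (factor_cov S' *v A' $ j)" and "d = d'"
proof -
  let ?O = "factor_cov S :: real ^ ('l + 'g) ^ ('l + 'g)" and ?O' = "factor_cov S' :: real ^ ('l + 'g) ^ ('l + 'g)"
  have sp: "sym_pos_def ?O" "sym_pos_def ?O'"
    using p by (auto simp: param_space_def intro: sym_pos_def_factor_cov)
  have sparse: "g \<noteq> t j \<Longrightarrow> A $ j $ Inr g = 0" "g \<noteq> t j \<Longrightarrow> A' $ j $ Inr g = 0" for j g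
    using p by (auto simp: param_space_def)
  have prob: "correct_prob t A d \<eta> j = std_normal_cdf (d $ j + A $ j \<bullet> \<eta>)"
    "correct_prob t A' d' \<eta> j = std_normal_cdf (d' $ j + A' $ j \<bullet> \<eta>)" for \<eta> j
    using sparse by (auto intro: correct_prob_inner)
  have success: "success_prob t (A, d, S) U = success_prob t (A', d', S') U" for U
    unfolding success_prob_def eq ..
  have mass: "emeasure (centred_normal ?O) UNIV = emeasure (centred_normal ?O') UNIV"
    using success[of "{}"] by (simp add: success_prob_eq) (simp add: centred_normal_def)
  define s where "s i = sqrt (1 + A $ i \<bullet> (?O *v A $ i))" for i
  define s' where "s' i = sqrt (1 + A' $ i \<bullet> (?O' *v A' $ i))" for i
  have quad: "0 \<le> v \<bullet> (T *v v)" if "sym_pos_def T" for v and T :: "real ^ ('l + 'g) ^ ('l + 'g)"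
    using that by (cases "v = 0") (auto simp: sym_pos_def_def less_imp_le)
  have s: "0 < s i" "(s i)\<^sup>2 = 1 + A $ i \<bullet> (?O *v A $ i)"
    and s': "0 < s' i" "(s' i)\<^sup>2 = 1 + A' $ i \<bullet> (?O' *v A' $ i)" for i
    using quad[OF sp(1), of "A $ i"] quad[OF sp(2), of "A' $ i"] by (auto simp: s_def s'_def)
  \<comment> \<open>One main factor and one testlet factor supply the two coordinates for the Gaussian reduction.\<close>
  have ne: "Inl undefined \<noteq> (Inr undefined :: 'l + 'g)" by simp
  have one: "(\<integral>\<^sup>+\<eta>. ennreal (std_normal_cdf (d $ i + A $ i \<bullet> \<eta>)) \<partial>centred_normal ?O)
      = (\<integral>\<^sup>+\<eta>. ennreal (std_normal_cdf (d' $ i + A' $ i \<bullet> \<eta>)) \<partial>centred_normal ?O')" for i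
    using success[of "{i}"] by (simp add: success_prob_eq prob)
  have two: "(\<integral>\<^sup>+\<eta>. ennreal (std_normal_cdf (d $ i + A $ i \<bullet> \<eta>)) * ennreal (std_normal_cdf (d $ j + A $ j \<bullet> \<eta>)) \<partial>centred_normal ?O)
      = (\<integral>\<^sup>+\<eta>. ennreal (std_normal_cdf (d' $ i + A' $ i \<bullet> \<eta>)) * ennreal (std_normal_cdf (d' $ j + A' $ j \<bullet> \<eta>)) \<partial>centred_normal ?O')"
    if "i \<noteq> j" for i j
    using success[of "{i, j}"] that by (simp add: success_prob_eq prob)
  let ?x = "\<lambda>i. (1 / s i) *\<^sub>R A $ i" and ?y = "\<lambda>i. (1 / s' i) *\<^sub>R A' $ i"
  have off: "?x i \<bullet> (?O *v ?x j) = ?y i \<bullet> (?O' *v ?y j)" if "i \<noteq> j" for i j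
    using correlation_determined[OF sp ne mass one one two[OF that]]
    by (simp add: s_def s'_def matrix_vector_mult_scaleR mult.commute)
  obtain B1 B2 B2a where B: "B1 \<inter> B2 = {}" "B2a \<subseteq> B2"
    and rk: "full_col_rank A B1 UNIV" "full_col_rank A B2a UNIV"
      "\<And>j. j \<in> B2a \<Longrightarrow> full_col_rank A (B2 - {j}) UNIV"
    using C1 unfolding cond_C1_def by blast
  have span: "span (?x ` B) = UNIV" if "full_col_rank A B UNIV" for B
    by (rule spanning_scaled[OF spanning_rows[OF that]]) (use s(1) in \<open>auto simp: less_imp_neq[symmetric]\<close>)
  have "gram_agree ?O ?x ?O' ?y UNIV UNIV"
    by (rule gram_diagonal_determined[OF sp off B]) (use span rk in auto)
  then have gram: "A $ i \<bullet> (?O *v A $ j) / (s i * s j) = A' $ i \<bullet> (?O' *v A' $ j) / (s' i * s' j)" for i j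
    by (simp add: gram_agree_def matrix_vector_mult_scaleR mult.commute)
  have ss': "s i = s' i" for i
  proof -
    have "((s i)\<^sup>2 - 1) / (s i)\<^sup>2 = ((s' i)\<^sup>2 - 1) / (s' i)\<^sup>2"
      using gram[of i i] by (simp add: s(2) s'(2) power2_eq_square[symmetric])
    then have "(s i)\<^sup>2 = (s' i)\<^sup>2" using s(1)[of i] s'(1)[of i] by (simp add: field_simps)
    then show ?thesis using s(1)[of i] s'(1)[of i] by (simp add: power2_eq_iff_nonneg)
  qed
  show "A $ i \<bullet> (?O *v A $ j) = A' $ i \<bullet> (?O' *v A' $ j)"
    using gram[of i j] s'(1)[of i] s'(1)[of j] by (simp add: ss')
  have "d $ i = d' $ i" for i
    using standardized_intercept_determined[OF sp ne mass one[of i]] s'(1)[of i] ss'[of i]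
    by (simp add: s_def s'_def)
  then show "d = d'" by (simp add: vec_eq_iff)
qed

section \<open>Loadings in the two-tier model\<close>

definition main_loadings :: "real ^ ('l::finite + 'g::finite) ^ 'j \<Rightarrow> 'j \<Rightarrow> real ^ 'l" where
  "main_loadings A i = (\<chi> l. A $ i $ Inl l)"

lemma spanning_main_loadings:
  fixes A :: "real ^ ('l::finite + 'g::finite) ^ 'j::finite"
  assumes "full_col_rank A B C" and "main_cols \<subseteq> C"
  shows "span (main_loadings A ` B) = UNIV"
proof (rule spanning_if_solvable)
  fix z :: "real^'l"
  obtain x where "\<forall>k\<in>C. (\<Sum>i\<in>B. x i * A $ i $ k) = (case k of Inl l \<Rightarrow> z $ l | Inr g \<Rightarrow> 0)"
    using full_col_rank_solvable[OF assms(1)] by blast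
  then have "(\<Sum>i\<in>B. x i * A $ i $ Inl l) = z $ l" for l
    using assms(2) by (auto dest!: bspec[of _ _ "Inl l"])
  then show "\<exists>x. (\<Sum>i\<in>B. x i *\<^sub>R main_loadings A i) = z"
    by (intro exI[of _ x]) (simp add: vec_eq_iff main_loadings_def)
qed

text \<open>
  Full column rank of \<open>\<bar>A\<close> on \<open>G1\<close> allows a combination of rows that picks out the single column of
  testlet \<open>g\<close>.
\<close>

lemma testlet_annihilator:
  fixes A :: "real ^ ('l::finite + 'g::finite) ^ 'j::finite"
  assumes "full_col_rank_bar t A G1" "g \<in> G1" and sparse: "\<And>j g. g \<noteq> t j \<Longrightarrow> A $ j $ Inr g = 0"
  shows "\<exists>x. (\<Sum>i\<in>t -` G1. x i *\<^sub>R main_loadings A i) = 0 \<and> (\<Sum>i\<in>t -` {g}. x i * A $ i $ Inr (t i)) = 1"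
proof -
  have "full_col_rank A (t -` G1) (main_cols \<union> Inr ` G1)"
    using assms(1) by (simp add: full_col_rank_bar_def)
  then obtain x where x: "\<forall>k\<in>main_cols \<union> Inr ` G1. (\<Sum>i\<in>t -` G1. x i * A $ i $ k) = (if k = Inr g then 1 else 0)"
    using full_col_rank_solvable[of A "t -` G1" _ "\<lambda>k. if k = Inr g then 1 else 0"] by blast
  have "(\<Sum>i\<in>t -` G1. x i * A $ i $ Inl l) = 0" for l using x by auto
  then have "(\<Sum>i\<in>t -` G1. x i *\<^sub>R main_loadings A i) = 0"
    by (simp add: vec_eq_iff main_loadings_def)
  moreover have "(\<Sum>i\<in>t -` {g}. x i * A $ i $ Inr (t i)) = (\<Sum>i\<in>t -` G1. x i * A $ i $ Inr g)"
    by (rule sum.mono_neutral_cong_left) (use assms(2) sparse in auto)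
  moreover have "\<dots> = 1" using x assms(2) by auto
  ultimately show ?thesis by auto
qed

text \<open>
  Testlet factors contribute to a covariance only when both items belong to the same testlet.
\<close>

lemma two_tier_gram:
  fixes A :: "real ^ ('l::finite + 'g::finite) ^ 'j"
  assumes "\<And>j g. g \<noteq> t j \<Longrightarrow> A $ j $ Inr g = 0"
  shows "A $ i \<bullet> (factor_cov S *v A $ j) = main_loadings A i \<bullet> (S *v main_loadings A j)
    + (if t i = t j then A $ i $ Inr (t i) * A $ j $ Inr (t j) else 0)"
proof -
  have "(\<Sum>g\<in>UNIV. A $ i $ Inr g * A $ j $ Inr g) = A $ i $ Inr (t i) * A $ j $ Inr (t i)"
    using assms by (subst sum.remove[of _ "t i"]) (auto intro!: sum.neutral)
  also have "\<dots> = (if t i = t j then A $ i $ Inr (t i) * A $ j $ Inr (t j) else 0)"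
    using assms[of "t i" j] by auto
  finally show ?thesis by (simp add: factor_cov_inner main_loadings_def)
qed

text \<open>
  The common form of (T2S) and (T3S): the testlets \<open>G1\<close> have full column rank including their own
  factors, and the main loadings of the remaining ones span.
\<close>

lemma main_gram_determined_if_split:
  fixes A A' :: "real ^ ('l::finite + 'g::finite) ^ 'j::finite"
  assumes S: "sym_pos_def S" "sym_pos_def S'"
    and sparse: "\<And>j g. g \<noteq> t j \<Longrightarrow> A $ j $ Inr g = 0"
    and eq: "\<And>i j. main_loadings A i \<bullet> (S *v main_loadings A j)
        + (if t i = t j then A $ i $ Inr (t i) * A $ j $ Inr (t j) else 0)
      = main_loadings A' i \<bullet> (S' *v main_loadings A' j)
        + (if t i = t j then A' $ i $ Inr (t i) * A' $ j $ Inr (t j) else 0)"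
    and G1: "full_col_rank_bar t A G1" and G2: "span (main_loadings A ` (t -` (- G1))) = UNIV"
  shows "gram_agree S (main_loadings A) S' (main_loadings A') UNIV UNIV"
proof (rule gram_agree_two_halves[OF S eq, of G1 "- G1"])
  show "span (main_loadings A ` (t -` G1)) = UNIV"
    by (rule spanning_main_loadings[OF G1[unfolded full_col_rank_bar_def]]) simp
  show "\<exists>x. (\<Sum>i\<in>t -` G1. x i *\<^sub>R main_loadings A i) = 0 \<and> (\<Sum>i\<in>t -` {g}. x i * A $ i $ Inr (t i)) = 1"
    if "g \<in> G1" for g
    by (rule testlet_annihilator[OF G1 that sparse])
qed (use G2 in auto)

lemma card_ge_3_obtain:
  assumes "card X \<ge> 3"
  obtains a b c where "a \<in> X" "b \<in> X" "c \<in> X" "a \<noteq> b" "a \<noteq> c" "b \<noteq> c"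
proof -
  obtain Y where "Y \<subseteq> X" "card Y = 3" using obtain_subset_with_card_n[OF assms] by metis
  then show thesis using that by (auto simp: card_3_iff)
qed

lemma testlet_loadings_determined:
  fixes A A' :: "real ^ ('l::finite + 'g::finite) ^ 'j::{finite,linorder}"
  assumes p: "(A, d, S) \<in> param_space t" "(A', d', S') \<in> param_space t"
    and prod: "\<And>i j. t i = t j \<Longrightarrow> A $ i $ Inr (t i) * A $ j $ Inr (t j) = A' $ i $ Inr (t i) * A' $ j $ Inr (t j)"
  shows "A $ i $ Inr g = A' $ i $ Inr g"
proof -
  have "(\<lambda>j. A $ j $ Inr g) = (\<lambda>j. A' $ j $ Inr g)"
  proof (rule column_eq_if_products_eq)
    show "A $ i $ Inr g * A $ j $ Inr g = A' $ i $ Inr g * A' $ j $ Inr g" for i j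
    proof (cases "t i = g \<and> t j = g")
      case True
      then show ?thesis using prod[of i j] by auto
    next
      case False
      then show ?thesis using p by (auto simp: param_space_def)
    qed
  qed (use p in \<open>auto simp: param_space_def\<close>)
  then show ?thesis by (rule fun_cong)
qed

section \<open>Identifiability\<close>

theorem theorem9:
  fixes t :: "'j::{finite,linorder} \<Rightarrow> 'g::finite"
    and A :: "real ^ ('l::finite + 'g) ^ ('j::{finite,linorder})"
    and d :: "real ^ ('j::{finite,linorder})"
    and \<Sigma> :: "real ^ 'l ^ 'l"
  assumes testlets_nonempty: "surj t"
    and param: "(A, d, \<Sigma>) \<in> param_space t"
    and C1: "cond_C1 A"
    and T: "cond_T1S t A \<or> cond_T2S t A \<or> cond_T3S t A"
  shows "identifiable_at t (A, d, \<Sigma>)"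
  unfolding identifiable_at_def
proof (intro ballI impI, elim conjE)
  fix p' :: "('j, 'l, 'g) two_tier_params"
  assume p': "p' \<in> param_space t"
    and eq: "response_distribution t p' = response_distribution t (A, d, \<Sigma>)"
    and pattern: "nonzero_pattern (fst p') = nonzero_pattern (fst (A, d, \<Sigma>))"
  obtain A' d' \<Sigma>' where p'_def: "p' = (A', d', \<Sigma>')" by (cases p')
  note param' = p'[unfolded p'_def]
  let ?m = "main_loadings A" and ?m' = "main_loadings A'"
  have S: "sym_pos_def \<Sigma>" "sym_pos_def \<Sigma>'"
    and sparse: "\<And>j g. g \<noteq> t j \<Longrightarrow> A $ j $ Inr g = 0" "\<And>j g. g \<noteq> t j \<Longrightarrow> A' $ j $ Inr g = 0"
    using param param' by (auto simp: param_space_def)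
  have zero: "A $ j $ k = 0 \<longleftrightarrow> A' $ j $ k = 0" for j k
  proof -
    have "nonzero_pattern A' $ j $ k = nonzero_pattern A $ j $ k" using pattern by (simp add: p'_def)
    then show ?thesis by (auto simp: nonzero_pattern_def split: if_splits)
  qed
  note determined = two_tier_covariances_determined[OF param param' C1 eq[unfolded p'_def]]
  have gram: "?m i \<bullet> (\<Sigma> *v ?m j) + (if t i = t j then A $ i $ Inr (t i) * A $ j $ Inr (t j) else 0)
      = ?m' i \<bullet> (\<Sigma>' *v ?m' j) + (if t i = t j then A' $ i $ Inr (t i) * A' $ j $ Inr (t j) else 0)" for i j
    using determined(1)[of i j] two_tier_gram[OF sparse(1)] two_tier_gram[OF sparse(2)] by simp
  have H4_span: "span (?m ` (t -` {g})) = UNIV" if "g \<in> H4 t A" for g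
    by (rule spanning_main_loadings[OF that[unfolded H4_def mem_Collect_eq] order_refl])
  have main: "gram_agree \<Sigma> ?m \<Sigma>' ?m' UNIV UNIV"
    using T
  proof (elim disjE)
    assume "cond_T1S t A"
    then obtain g h k where ghk: "g \<in> H4 t A" "h \<in> H4 t A" "k \<in> H4 t A" "g \<noteq> h" "g \<noteq> k" "h \<noteq> k"
      unfolding cond_T1S_def by (metis card_ge_3_obtain)
    show ?thesis
    proof (rule gram_agree_three_groups[OF S _ ghk(4-6)])
      show "?m i \<bullet> (\<Sigma> *v ?m j) = ?m' i \<bullet> (\<Sigma>' *v ?m' j)" if "t i \<noteq> t j" for i j
        using gram[of i j] that by simp
    qed (use H4_span ghk in auto)
  next
    \<comment> \<open>Splitting off a testlet of \<open>\<H>\<^sub>5\<close> gives the situation of (T3S): the rest contains another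
      testlet of \<open>\<H>\<^sub>4\<close>.\<close>
    assume T2: "cond_T2S t A"
    then obtain g where g: "full_col_rank_bar t A {g}"
      unfolding cond_T2S_def H5_def by (metis (mono_tags, lifting) One_nat_def card.empty empty_Collect_eq not_less_eq_eq zero_le)
    obtain h where h: "h \<in> H4 t A" "h \<noteq> g"
    proof -
      have "\<not> H4 t A \<subseteq> {g}"
        using T2 card_mono[of "{g}" "H4 t A"] by (auto simp: cond_T2S_def)
      then show thesis using that by auto
    qed
    have "span (?m ` (t -` {h})) \<subseteq> span (?m ` (t -` (- {g})))"
      by (intro span_mono image_mono) (use h in auto)
    then have "span (?m ` (t -` (- {g}))) = UNIV" using H4_span[OF h(1)] by auto
    with g show ?thesis by (intro main_gram_determined_if_split[OF S sparse(1) gram])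
  next
    assume "cond_T3S t A"
    then obtain G1 G2 where G: "G1 \<union> G2 = UNIV" "G1 \<inter> G2 = {}"
      and G1: "full_col_rank_bar t A G1" and G2: "full_col_rank A (t -` G2) main_cols"
      unfolding cond_T3S_def by blast
    have "G2 = - G1" using G by auto
    then have "span (?m ` (t -` (- G1))) = UNIV" using spanning_main_loadings[OF G2] by simp
    with G1 show ?thesis by (intro main_gram_determined_if_split[OF S sparse(1) gram])
  qed
  have identity: "contains_identity A UNIV"
    using T by (auto simp: cond_T1S_def cond_T2S_def cond_T3S_def contains_identity_def)
  have "\<exists>B. full_col_rank A B UNIV" using C1 by (auto simp: cond_C1_def)
  then obtain B where "full_col_rank A B UNIV" ..
  then have "span (?m ` B) = UNIV" by (rule spanning_main_loadings) simp
  then have span: "span (range ?m) = UNIV" using span_mono[of "?m ` B" "range ?m"] by auto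
  have "?m = ?m' \<and> \<Sigma> = \<Sigma>'"
  proof (rule main_part_determined[OF S _ _ main span])
    show "\<Sigma> $ l $ l = 1" "\<Sigma>' $ l $ l = 1" for l using param param' by (auto simp: param_space_def)
    show "?m j $ l = 0 \<longleftrightarrow> ?m' j $ l = 0" for j l by (simp add: main_loadings_def zero)
    show "\<exists>j. ?m j $ l \<noteq> 0 \<and> (\<forall>l'. l' \<noteq> l \<longrightarrow> ?m j $ l' = 0)" for l
      using identity by (simp add: contains_identity_def main_loadings_def)
    show "?m j $ l \<noteq> 0 \<Longrightarrow> \<forall>i<j. ?m i $ l = 0 \<Longrightarrow> 0 < ?m j $ l"
      and "?m' j $ l \<noteq> 0 \<Longrightarrow> \<forall>i<j. ?m' i $ l = 0 \<Longrightarrow> 0 < ?m' j $ l" for l j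
      using param param' by (auto simp: param_space_def main_loadings_def)
  qed
  then have m: "?m = ?m'" and \<Sigma>: "\<Sigma> = \<Sigma>'" by auto
  have "A $ i $ k = A' $ i $ k" for i k
  proof (cases k)
    case (Inl l)
    then show ?thesis using fun_cong[OF m, of i] by (simp add: main_loadings_def vec_eq_iff)
  next
    case (Inr g)
    have "A $ i $ Inr (t i) * A $ j $ Inr (t j) = A' $ i $ Inr (t i) * A' $ j $ Inr (t j)"
      if "t i = t j" for i j
      using gram[of i j] that main by (simp add: gram_agree_def)
    then show ?thesis unfolding Inr by (rule testlet_loadings_determined[OF param param'])
  qed
  then have "A = A'" by (simp add: vec_eq_iff)
  then show "p' = (A, d, \<Sigma>)" using determined(2) \<Sigma> by (simp add: p'_def)
qed

end
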